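(* Let $d$ be a positive integer. Let $\{(M_t,Z_t);t=1,2,\ldots\}$ be i.i.d. random elements in $(\mathbb{R}^{d\times d}\times\mathbb{R}^d,\mathscr{R}^{d\times d}\times\mathscr{R}^d)$, and let $Z_0$ be a random element in $(\mathbb{R}^d,\mathscr{R}^d)$ independent of $\{(M_t,Z_t);t=1,2,\ldots\}$. Define the random sequence $\{X_t;t=1,2,\ldots\}$ by \[ X_0=Z_0;\qquad X_t = M_tX_{t-1} + Z_{t}\qquad\forall t=1,2,\ldots. \] Assume that $\left\Vert \prod_{t=1}^n M_t\right\Vert \to 0$ almost surely as $n\to\infty$. Then the following six statements are equivalent: (i) $X_t$ converges in distribution as $t\to\infty$; (ii) $\sum_{t=1}^\infty\left|\prod_{j=1}^{t-1}M_jZ_{t}\right|<\infty$ almost surely; (iii) $\sum_{i=1}^t\prod_{j=1}^{i-1}M_jZ_{i}$ converges almost surely as $t\to\infty$; (iv) $\prod_{j=1}^{t-1}M_jZ_{t}\to 0$ almost surely as $t\to\infty$; (v) $\sup_{t=1,2,\ldots}\left|\prod_{j=1}^{t-1}M_jZ_{t}\right|<\infty$ almost surely; (vi) $\sum_{t=1}^\infty \mathbb{P}\left(\min_{k=1,\ldots,t-1}\left|\prod_{j=k}^{t-1}M_jZ_t\right|> x\right)<\infty$ for all $x>0$.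
   Context: $|\cdot|$ denotes the Euclidean norm on $\mathbb{R}^d$. $\mathbb{R}^{d\times d}$ is the space of real $d\times d$ matrices, and $\Vert\cdot\Vert$ is the matrix norm induced by $|\cdot|$, i.e. $\Vert A\Vert=\max_{|x|=1}|Ax|$ (the spectral norm). $\mathscr{R}^d$ and $\mathscr{R}^{d\times d}$ denote the Borel $\sigma$-algebras on $\mathbb{R}^d$ and $\mathbb{R}^{d\times d}$. Here the pairs $(M_t,Z_t)$ are i.i.d. in $t$; for a given $t$, $M_t$ and $Z_t$ are not assumed to be independent of each other. Matrix products are ordered with increasing index from left to right: $\prod_{j=m}^n M_j = M_mM_{m+1}\cdots M_n$ if $m\le n$, and $\prod_{j=m}^n M_j = I_d$ (the $d\times d$ identity matrix) if $m>n$. An expression such as $\prod_{j=k}^{t-1}M_jZ_t$ means the matrix product $\prod_{j=k}^{t-1}M_j$ applied to the vector $Z_t$, i.e. $M_kM_{k+1}\cdots M_{t-1}Z_t$. By convention, a minimum over an empty set equals $\infty$ (this is relevant for the $t=1$ term in (vi)). *)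

theory Defs
  imports "HOL-Probability.Probability"
begin

definition mat_prod :: "(nat \<Rightarrow> real ^ 'd ^ 'd) \<Rightarrow> nat \<Rightarrow> nat \<Rightarrow> real ^ 'd ^ 'd"
  where "mat_prod A m n = foldr (**) (map A [m..<Suc n]) (mat 1)"

text \<open>The norm of the type class on matrices is the Frobenius norm, so the spectral norm
  is taken as the operator norm of the induced linear map.\<close>

definition spectral_norm :: "real ^ 'd ^ 'd \<Rightarrow> real"
  where "spectral_norm A = onorm ((*v) A)"

text \<open>The sequences \<open>M\<close> and \<open>Z\<close> are indexed by all of \<open>nat\<close>; \<open>M 0\<close> is never used,
  and \<open>Z 0\<close> is the initial value.\<close>

primrec affine_recursion ::
    "(nat \<Rightarrow> 'w \<Rightarrow> real ^ 'd ^ 'd) \<Rightarrow> (nat \<Rightarrow> 'w \<Rightarrow> real ^ 'd) \<Rightarrow> nat \<Rightarrow> 'w \<Rightarrow> real ^ 'd"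
  where
    "affine_recursion M Z 0 \<omega> = Z 0 \<omega>"
  | "affine_recursion M Z (Suc t) \<omega> = M (Suc t) \<omega> *v affine_recursion M Z t \<omega> + Z (Suc t) \<omega>"

text \<open>Weak convergence of the laws to some Borel probability measure. The predicate
  \<open>weak_conv_m\<close> of the library only covers real-valued random variables.\<close>

definition converges_in_distribution ::
    "'w measure \<Rightarrow> (nat \<Rightarrow> 'w \<Rightarrow> 'a :: topological_space) \<Rightarrow> bool"
  where "converges_in_distribution P X \<longleftrightarrow>
    (\<exists>\<mu>. prob_space \<mu> \<and> sets \<mu> = sets borel \<and>
      (\<forall>f :: 'a \<Rightarrow> real. continuous_on UNIV f \<and> bounded (range f) \<longrightarrow>
        (\<lambda>t. \<integral>x. f x \<partial>distr P borel (X t)) \<longlonglongrightarrow> (\<integral>x. f x \<partial>\<mu>)))"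

text \<open>The library constant \<open>prob_space.indep_var\<close> forces both random variables to have values in
  the same type; this is the same notion for two different value types.\<close>

definition indep_rvs ::
    "'w measure \<Rightarrow> 'a measure \<Rightarrow> ('w \<Rightarrow> 'a) \<Rightarrow> 'b measure \<Rightarrow> ('w \<Rightarrow> 'b) \<Rightarrow> bool"
  where "indep_rvs P S X T Y \<longleftrightarrow>
    X \<in> measurable P S \<and> Y \<in> measurable P T \<and>
    prob_space.indep_set P {X -` A \<inter> space P |A. A \<in> sets S} {Y -` B \<inter> space P |B. B \<in> sets T}"

definition all_equivalent :: "bool list \<Rightarrow> bool"
  where "all_equivalent ps \<longleftrightarrow> (\<forall>p\<in>set ps. \<forall>q\<in>set ps. p \<longleftrightarrow> q)"

end

theory Submission
  imports Defs
begin

text \<open>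
  Write \<open>\<Pi>\<^sub>n = M\<^sub>1 \<cdots> M\<^sub>n\<close>, \<open>a\<^sub>n = \<Pi>\<^sub>n Z\<^bsub>n+1\<^esub>\<close> and \<open>S\<^sub>n = a\<^sub>0 + \<cdots> + a\<^bsub>n-1\<^esub>\<close>. The chain
  (ii) \<open>\<Longrightarrow>\<close> (iii) \<open>\<Longrightarrow>\<close> (iv) \<open>\<Longrightarrow>\<close> (v) holds pointwise. The other implications rest on the space of sequences
  \<open>((M\<^sub>1, Z\<^sub>1), (M\<^sub>2, Z\<^sub>2), \<dots>)\<close> with its product measure, where the shift preserves the measure and
  the sequence shifted by \<open>k\<close> is independent of the first \<open>k\<close> coordinates. From (v) over
  (iv) and (vi) to (ii), the matrices enter only through \<open>|a\<^bsub>k+n\<^esub>| \<le> \<parallel>\<Pi>\<^sub>k\<parallel> |a\<^sub>n \<circ> shift\<^sup>k|\<close>, and so this part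
  is given for real terms \<open>g\<close> dominated in this way by a submultiplicative sequence \<open>q\<close>.

  (v) \<open>\<Longrightarrow>\<close> (iv): \<open>sup\<^bsub>n\<ge>s\<^esub> |a\<^sub>n|\<close> is at most \<open>\<parallel>\<Pi>\<^sub>s\<parallel>\<close> times a variable whose law does not depend
  on \<open>s\<close>. It therefore tends to \<open>0\<close> in probability as \<open>s\<close> grows, and almost surely because it is
  monotone (\<open>AE_tendsto_0_if_AE_bounded\<close>).

  (iv) \<open>\<Longrightarrow>\<close> (vi): the \<open>n\<close>-th event of (vi) depends on the first \<open>n + 1\<close> coordinates. After it, the
  shifted terms from the \<open>m\<close>-th on do not exceed \<open>x\<close> with a probability \<open>p > 0\<close> independently of the
  past, and then no event with a number above \<open>n + m\<close> occurs. So at most \<open>m + 1\<close> of the events are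
  followed by such a quiet future, and \<open>p\<close> times the series in (vi) is at most \<open>m + 1\<close>
  (\<open>summable_stays_above_if_AE_tendsto_0\<close>).

  (vi) \<open>\<Longrightarrow>\<close> (ii): outside the \<open>n\<close>-th event of (vi) some vector \<open>M\<^bsub>k+1\<^esub> \<cdots> M\<^sub>n Z\<^bsub>n+1\<^esub>\<close> with \<open>k < n\<close>
  has length at most \<open>x\<close>. For the last such \<open>k\<close>, \<open>|a\<^sub>n| \<le> x \<parallel>\<Pi>\<^sub>k\<parallel>\<close>. The number of those \<open>n\<close> that select
  a given \<open>k\<close> is independent of \<open>\<Pi>\<^sub>k\<close>, and its mean is at most \<open>1\<close> because the probabilities
  telescope (\<open>sum_prob_drops_below_le_1\<close>). Up to finitely many terms, \<open>\<Sum> |a\<^sub>n|\<close> is thus controlled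
  by \<open>\<Sum> \<parallel>\<Pi>\<^sub>k\<parallel>\<close>. This last series converges by the same argument, applied to the terms
  \<open>\<parallel>\<Pi>\<^sub>n\<parallel>\<close> themselves with \<open>x = 1/2\<close>: its truncated means are bounded by a constant plus half of
  themselves (\<open>summable_integral_capped\<close>).

  (iii) \<open>\<Longrightarrow>\<close> (i) and (i) \<open>\<Longrightarrow>\<close> (v): reversing the order of the first \<open>n\<close> pairs preserves their law
  and turns \<open>X\<^sub>n\<close> into \<open>Y\<^sub>n = S\<^sub>n + \<Pi>\<^sub>n Z\<^sub>0\<close>, so \<open>X\<^sub>n\<close> and \<open>Y\<^sub>n\<close> are equal in law. If \<open>S\<^sub>n\<close> converges, so
  does \<open>Y\<^sub>n\<close>. Conversely, convergence in distribution makes the laws of \<open>Y\<^sub>n\<close> tight, and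
  an inequality of Ottaviani type (\<open>maximal_inequality\<close>) turns this into boundedness of the paths
  of \<open>S\<close>, hence of its increments \<open>a\<^sub>n\<close>.
\<close>

section \<open>Independence of the past and the shifted future\<close>

definition seq_shift :: "nat \<Rightarrow> (nat \<Rightarrow> 'a) \<Rightarrow> nat \<Rightarrow> 'a" where
  "seq_shift k \<omega> = (\<lambda>i. \<omega> (k + i))"

definition determined_by_first :: "nat \<Rightarrow> ((nat \<Rightarrow> 'a) \<Rightarrow> 'b) \<Rightarrow> bool" where
  "determined_by_first k f \<longleftrightarrow> (\<forall>\<omega> \<omega>'. (\<forall>i<k. \<omega> i = \<omega>' i) \<longrightarrow> f \<omega> = f \<omega>')"

lemma seq_shift_0 [simp]: "seq_shift 0 \<omega> = \<omega>"
  by (simp add: seq_shift_def)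

lemma seq_shift_add [simp]: "seq_shift j (seq_shift k \<omega>) = seq_shift (k + j) \<omega>"
  by (simp add: seq_shift_def add.assoc)

lemma shift_comb_seq [simp]: "seq_shift k (comb_seq k \<omega> \<omega>') = \<omega>'"
  by (auto simp: seq_shift_def comb_seq_def)

lemma determined_by_firstD:
  "determined_by_first k f \<Longrightarrow> (\<And>i. i < k \<Longrightarrow> \<omega> i = \<omega>' i) \<Longrightarrow> f \<omega> = f \<omega>'"
  by (auto simp: determined_by_first_def)

lemma determined_by_first_mono:
  "determined_by_first k f \<Longrightarrow> k \<le> l \<Longrightarrow> determined_by_first l f"
  unfolding determined_by_first_def by (meson order_less_le_trans)

text \<open>Bounded convergence for the indicators. It turns almost sure bounds into choices of levels and
  times at which a failure is unlikely.\<close>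

lemma (in prob_space) prob_tendsto_0_if_AE_eventually_not:
  assumes meas: "\<And>n. Measurable.pred M (E n)"
    and ev: "AE \<omega> in M. eventually (\<lambda>n. \<not> E n \<omega>) sequentially"
  shows "(\<lambda>n. prob {\<omega> \<in> space M. E n \<omega>}) \<longlonglongrightarrow> 0"
proof -
  have "(\<lambda>n. \<integral>\<omega>. indicator {\<omega> \<in> space M. E n \<omega>} \<omega> \<partial>M) \<longlonglongrightarrow> (\<integral>\<omega>. (0::real) \<partial>M)"
  proof (rule integral_dominated_convergence[where w = "\<lambda>_. 1"])
    show "AE \<omega> in M. (\<lambda>n. indicator {\<omega> \<in> space M. E n \<omega>} \<omega>) \<longlonglongrightarrow> (0::real)"
      using ev
    proof eventually_elim
      case (elim \<omega>)
      then show ?case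
        by (intro tendsto_eventually) (auto elim!: eventually_mono)
    qed
  qed (use meas in \<open>auto simp: indicator_def\<close>)
  moreover have "{\<omega> \<in> space M. E n \<omega>} \<inter> space M = {\<omega> \<in> space M. E n \<omega>}" for n
    by blast
  ultimately show ?thesis
    by simp
qed

context sequence_space
begin

lemma measurable_seq_shift [measurable]: "seq_shift k \<in> S \<rightarrow>\<^sub>M S"
  unfolding seq_shift_def by (rule measurable_PiM_single') (simp_all add: space_PiM PiE_iff)

lemma nn_integral_split:
  assumes [measurable]: "F \<in> borel_measurable S"
  shows "(\<integral>\<^sup>+\<omega>. F \<omega> \<partial>S) = (\<integral>\<^sup>+\<omega>. \<integral>\<^sup>+\<omega>'. F (comb_seq k \<omega> \<omega>') \<partial>S \<partial>S)"
proof -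
  have "(\<integral>\<^sup>+\<omega>. F \<omega> \<partial>S) = (\<integral>\<^sup>+\<omega>. F \<omega> \<partial>distr (S \<Otimes>\<^sub>M S) S (\<lambda>(\<omega>, \<omega>'). comb_seq k \<omega> \<omega>'))"
    by (simp only: PiM_comb_seq)
  also have "\<dots> = (\<integral>\<^sup>+p. F (case p of (\<omega>, \<omega>') \<Rightarrow> comb_seq k \<omega> \<omega>') \<partial>(S \<Otimes>\<^sub>M S))"
    by (rule nn_integral_distr) simp_all
  also have "\<dots> = (\<integral>\<^sup>+\<omega>. \<integral>\<^sup>+\<omega>'. F (comb_seq k \<omega> \<omega>') \<partial>S \<partial>S)"
    by (subst P.nn_integral_fst[symmetric]) simp_all
  finally show ?thesis .
qed

text \<open>In \<open>comb_seq k \<omega> \<omega>'\<close> with independent \<open>\<omega>\<close> and \<open>\<omega>'\<close>, the first factor sees only \<open>\<omega>\<close> and the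
  second only \<open>\<omega>'\<close>.\<close>

lemma nn_integral_mult_shift:
  fixes f h :: "(nat \<Rightarrow> 'a) \<Rightarrow> ennreal"
  assumes [measurable]: "f \<in> borel_measurable S" "h \<in> borel_measurable S"
    and f: "determined_by_first k f"
  shows "(\<integral>\<^sup>+\<omega>. f \<omega> * h (seq_shift k \<omega>) \<partial>S) = (\<integral>\<^sup>+\<omega>. f \<omega> \<partial>S) * (\<integral>\<^sup>+\<omega>. h \<omega> \<partial>S)"
proof -
  have *: "f (comb_seq k \<omega> \<omega>') = f \<omega>" for \<omega> \<omega>'
    by (rule determined_by_firstD[OF f]) (simp add: comb_seq_less)
  show ?thesis
    by (subst nn_integral_split[of _ k])
       (simp_all add: * nn_integral_cmult nn_integral_multc)
qed

lemma integral_mult_shift: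
  fixes f h :: "(nat \<Rightarrow> 'a) \<Rightarrow> real"
  assumes [measurable]: "f \<in> borel_measurable S" "h \<in> borel_measurable S"
    and f: "determined_by_first k f"
    and nonneg: "\<And>\<omega>. 0 \<le> f \<omega>" "\<And>\<omega>. 0 \<le> h \<omega>"
  shows "(\<integral>\<omega>. f \<omega> * h (seq_shift k \<omega>) \<partial>S) = (\<integral>\<omega>. f \<omega> \<partial>S) * (\<integral>\<omega>. h \<omega> \<partial>S)"
proof -
  have "determined_by_first k (\<lambda>\<omega>. ennreal (f \<omega>))"
    using f unfolding determined_by_first_def by metis
  from nn_integral_mult_shift[OF _ _ this, of "\<lambda>\<omega>. ennreal (h \<omega>)"]
  show ?thesis
    by (simp add: integral_eq_nn_integral nonneg ennreal_mult enn2real_mult)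
qed

lemma prob_eq_integral_of_bool:
  assumes [measurable]: "Measurable.pred S E"
  shows "measure S {\<omega> \<in> space S. E \<omega>} = (\<integral>\<omega>. of_bool (E \<omega>) \<partial>S)"
proof -
  have "(\<integral>\<omega>. of_bool (E \<omega>) \<partial>S) = (\<integral>\<omega>. indicator {\<omega> \<in> space S. E \<omega>} \<omega> \<partial>S)"
    by (intro Bochner_Integration.integral_cong) (auto simp: indicator_def)
  also have "\<dots> = measure S ({\<omega> \<in> space S. E \<omega>} \<inter> space S)"
    by simp
  also have "{\<omega> \<in> space S. E \<omega>} \<inter> space S = {\<omega> \<in> space S. E \<omega>}"
    by blast
  finally show ?thesis by simp
qed

lemma prob_conj_shift:
  assumes [measurable]: "Measurable.pred S E" "Measurable.pred S F"
    and E: "determined_by_first k E"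
  shows "measure S {\<omega> \<in> space S. E \<omega> \<and> F (seq_shift k \<omega>)}
    = measure S {\<omega> \<in> space S. E \<omega>} * measure S {\<omega> \<in> space S. F \<omega>}"
proof -
  have "determined_by_first k (\<lambda>\<omega>. of_bool (E \<omega>) :: real)"
    using E unfolding determined_by_first_def
    by (intro allI impI arg_cong[where f = of_bool]) blast
  then have "(\<integral>\<omega>. of_bool (E \<omega>) * of_bool (F (seq_shift k \<omega>)) \<partial>S)
      = (\<integral>\<omega>. of_bool (E \<omega>) \<partial>S) * (\<integral>\<omega>. of_bool (F \<omega>) \<partial>S :: real)"
    by (intro integral_mult_shift[where h = "\<lambda>\<omega>. of_bool (F \<omega>)"]) simp_all
  then show ?thesis
    by (subst (1 2 3) prob_eq_integral_of_bool) (simp_all add: of_bool_conj)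
qed

lemma prob_shift:
  assumes "Measurable.pred S E"
  shows "measure S {\<omega> \<in> space S. E (seq_shift k \<omega>)} = measure S {\<omega> \<in> space S. E \<omega>}"
  using prob_conj_shift[of "\<lambda>_. True" E k] assms
  by (simp add: determined_by_first_def P.prob_space)

end

section \<open>Terms dominated by a contracting submultiplicative sequence\<close>

text \<open>The model for \<open>q n\<close> is the norm of a product of \<open>n\<close> independent matrices. For a nonnegative term
  sequence \<open>g\<close>, the relevant bound is \<open>g (k + n) \<le> q k * g n\<close> with the second factor shifted by \<open>k\<close>.
  One admissible choice is \<open>g = q\<close>; it shows that truncations of \<open>q\<close> have summable means, on which
  the summability of every other \<open>g\<close> rests.\<close>

locale contracting_sequence = sequence_space M for M :: "'a measure" +
  fixes q :: "nat \<Rightarrow> (nat \<Rightarrow> 'a) \<Rightarrow> real"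
  assumes q_measurable [measurable]: "\<And>n. q n \<in> borel_measurable S"
    and q_nonneg: "\<And>n \<omega>. 0 \<le> q n \<omega>"
    and q_determined: "\<And>n. determined_by_first n (q n)"
    and q_submult: "\<And>k n \<omega>. q (k + n) \<omega> \<le> q k \<omega> * q n (seq_shift k \<omega>)"
    and q_tendsto_0: "AE \<omega> in S. (\<lambda>n. q n \<omega>) \<longlonglongrightarrow> 0"
begin

text \<open>The variable \<open>q n\<close> need not have a mean. Replacing it by \<open>0\<close> from the first time that \<open>q\<close> exceeds
  \<open>L\<close> makes it bounded and keeps it a function of the first \<open>n\<close> coordinates; on almost every path
  this changes nothing once \<open>L\<close> is large. The cap has to look at the whole past, so that
  if \<open>q n\<close> survives, every earlier \<open>q k\<close> does as well.\<close>

definition capped :: "real \<Rightarrow> nat \<Rightarrow> (nat \<Rightarrow> 'a) \<Rightarrow> real" where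
  "capped L n \<omega> = (if \<forall>i\<le>n. q i \<omega> \<le> L then q n \<omega> else 0)"

lemma measurable_capped [measurable]: "capped L n \<in> borel_measurable S"
  unfolding capped_def by measurable

lemma capped_nonneg: "0 \<le> capped L n \<omega>"
  by (simp add: capped_def q_nonneg)

lemma capped_le: "0 \<le> L \<Longrightarrow> capped L n \<omega> \<le> L"
  by (simp add: capped_def)

lemma determined_capped: "determined_by_first n (capped L n)"
proof -
  have "q i \<omega> = q i \<omega>'" if "\<forall>j<n. \<omega> j = \<omega>' j" "i \<le> n" for \<omega> \<omega>' :: "nat \<Rightarrow> 'a" and i
    using that by (intro determined_by_firstD[OF q_determined]) auto
  then have "(\<forall>i\<le>n. q i \<omega> \<le> L) = (\<forall>i\<le>n. q i \<omega>' \<le> L)" "q n \<omega> = q n \<omega>'"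
    if "\<forall>j<n. \<omega> j = \<omega>' j" for \<omega> \<omega>' :: "nat \<Rightarrow> 'a"
    using that by (metis order_refl)+
  then show ?thesis
    unfolding capped_def determined_by_first_def by (metis (full_types))
qed

lemma integrable_capped: "0 \<le> L \<Longrightarrow> integrable S (capped L n)"
  by (rule P.integrable_const_bound[where B = L]) (simp_all add: capped_nonneg capped_le)

end

locale contracted_terms = contracting_sequence M q
  for M :: "'a measure" and q :: "nat \<Rightarrow> (nat \<Rightarrow> 'a) \<Rightarrow> real" +
  fixes g :: "nat \<Rightarrow> (nat \<Rightarrow> 'a) \<Rightarrow> real"
  assumes g_measurable [measurable]: "\<And>n. g n \<in> borel_measurable S"
    and g_nonneg: "\<And>n \<omega>. 0 \<le> g n \<omega>"
    and g_determined: "\<And>n. determined_by_first (Suc n) (g n)"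
    and g_submult: "\<And>k n \<omega>. g (k + n) \<omega> \<le> q k \<omega> * g n (seq_shift k \<omega>)"
begin

text \<open>This is the event in condition (vi). Its bound concerns the terms that end at time \<open>n\<close>
  and start at one of the times \<open>k < n\<close>.\<close>

definition stays_above :: "real \<Rightarrow> nat \<Rightarrow> (nat \<Rightarrow> 'a) \<Rightarrow> bool" where
  "stays_above x n \<omega> \<longleftrightarrow> (\<forall>k<n. x < g (n - k) (seq_shift k \<omega>))"

lemma measurable_stays_above [measurable]: "Measurable.pred S (stays_above x n)"
  unfolding stays_above_def by measurable

lemma determined_stays_above: "determined_by_first (Suc n) (stays_above x n)"
proof -
  have "g (n - k) (seq_shift k \<omega>) = g (n - k) (seq_shift k \<omega>')"
    if "\<forall>i<Suc n. \<omega> i = \<omega>' i" "k < n" for \<omega> \<omega>' :: "nat \<Rightarrow> 'a" and k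
    using that by (intro determined_by_firstD[OF g_determined]) (auto simp: seq_shift_def)
  then show ?thesis
    unfolding stays_above_def determined_by_first_def by metis
qed

text \<open>The tail after time \<open>s\<close> is at most \<open>q s\<close> times the supremum of the shifted terms. The first factor
  tends to \<open>0\<close> and the law of the second does not depend on \<open>s\<close>.\<close>

lemma AE_tendsto_0_if_AE_bounded:
  assumes bdd: "AE \<omega> in S. bdd_above (range (\<lambda>n. g n \<omega>))"
  shows "AE \<omega> in S. (\<lambda>n. g n \<omega>) \<longlonglongrightarrow> 0"
proof -
  have null: "AE \<omega> in S. \<exists>s. \<forall>n\<ge>s. g n \<omega> \<le> e" if "e > 0" for e
  proof -
    define E where "E = (\<lambda>s \<omega>. \<exists>n\<ge>s. e < g n \<omega>)"
    have [measurable]: "Measurable.pred S (E s)" for s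
      unfolding E_def by measurable
    define N where "N = {\<omega> \<in> space S. \<forall>s. E s \<omega>}"
    have N [measurable]: "N \<in> sets S"
      unfolding N_def by measurable
    have "measure S N \<le> 0"
    proof (rule field_le_epsilon)
      fix \<delta> :: real assume \<delta>: "\<delta> > 0"
      have "(\<lambda>R. measure S {\<omega> \<in> space S. \<exists>n. real R < g n \<omega>}) \<longlonglongrightarrow> 0"
      proof (rule P.prob_tendsto_0_if_AE_eventually_not)
        show "AE \<omega> in S. eventually (\<lambda>R. \<not> (\<exists>n. real R < g n \<omega>)) sequentially"
          using bdd
        proof eventually_elim
          case (elim \<omega>)
          then obtain B where B: "\<And>n. g n \<omega> \<le> B"
            by (auto simp: bdd_above_def)
          obtain R0 where "B \<le> real R0"
            using real_arch_simple by blast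
          then have "\<not> (\<exists>n. real R < g n \<omega>)" if "R \<ge> R0" for R
            using B that by (meson not_less of_nat_mono order_trans)
          then show ?case
            unfolding eventually_sequentially by blast
        qed
      qed simp
      \<comment> \<open>The supremum of the terms exceeds \<open>R\<close> with probability below \<open>\<delta> / 2\<close>; this applies after every
        shift with the same \<open>R\<close>, which is why \<open>s\<close> can be chosen afterwards.\<close>
      from order_tendstoD(2)[OF this, of "\<delta> / 2"] \<delta>
      have "eventually (\<lambda>R. measure S {\<omega> \<in> space S. \<exists>n. real R < g n \<omega>} < \<delta> / 2 \<and> R > 0) sequentially"
        by (intro eventually_conj eventually_gt_at_top) simp_all
      then obtain R where R: "measure S {\<omega> \<in> space S. \<exists>n. real R < g n \<omega>} < \<delta> / 2" "R > 0"
        by (auto simp: eventually_sequentially)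
      have "(\<lambda>s. measure S {\<omega> \<in> space S. e / R < q s \<omega>}) \<longlonglongrightarrow> 0"
      proof (rule P.prob_tendsto_0_if_AE_eventually_not)
        show "AE \<omega> in S. eventually (\<lambda>s. \<not> e / R < q s \<omega>) sequentially"
          using q_tendsto_0
        proof eventually_elim
          case (elim \<omega>)
          from order_tendstoD(2)[OF this, of "e / R"] \<open>e > 0\<close> R(2)
          show ?case by (auto elim!: eventually_mono)
        qed
      qed simp
      from order_tendstoD(2)[OF this, of "\<delta> / 2"] \<delta>
      obtain s where s: "measure S {\<omega> \<in> space S. e / R < q s \<omega>} < \<delta> / 2"
        by (auto simp: eventually_sequentially)
      have "measure S N \<le> measure S ({\<omega> \<in> space S. e / R < q s \<omega>}
          \<union> {\<omega> \<in> space S. \<exists>n. real R < g n (seq_shift s \<omega>)})"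
      proof (rule P.finite_measure_mono)
        show "N \<subseteq> {\<omega> \<in> space S. e / R < q s \<omega>} \<union> {\<omega> \<in> space S. \<exists>n. real R < g n (seq_shift s \<omega>)}"
        proof
          fix \<omega> assume "\<omega> \<in> N"
          then obtain n where n: "\<omega> \<in> space S" "n \<ge> s" "e < g n \<omega>"
            by (auto simp: N_def E_def)
          have "g n \<omega> \<le> q s \<omega> * g (n - s) (seq_shift s \<omega>)"
            using g_submult[of s "n - s" \<omega>] n(2) by simp
          moreover have "q s \<omega> * g (n - s) (seq_shift s \<omega>) \<le> e / R * R"
            if "q s \<omega> \<le> e / R" "g (n - s) (seq_shift s \<omega>) \<le> R"
            using that q_nonneg g_nonneg \<open>e > 0\<close> R(2) by (intro mult_mono) auto
          ultimately have "e / R < q s \<omega> \<or> real R < g (n - s) (seq_shift s \<omega>)"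
            using n(3) R(2) by force
          then show "\<omega> \<in> {\<omega> \<in> space S. e / R < q s \<omega>} \<union> {\<omega> \<in> space S. \<exists>n. real R < g n (seq_shift s \<omega>)}"
            using n(1) by auto
        qed
      qed simp
      also have "\<dots> \<le> measure S {\<omega> \<in> space S. e / R < q s \<omega>}
          + measure S {\<omega> \<in> space S. \<exists>n. real R < g n (seq_shift s \<omega>)}"
        by (rule measure_subadditive) simp_all
      also have "measure S {\<omega> \<in> space S. \<exists>n. real R < g n (seq_shift s \<omega>)}
          = measure S {\<omega> \<in> space S. \<exists>n. real R < g n \<omega>}"
        by (rule prob_shift[where E = "\<lambda>\<omega>. \<exists>n. real R < g n \<omega>"]) simp
      finally show "measure S N \<le> 0 + \<delta>"
        using R(1) s by simp
    qed
    then have "measure S N = 0"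
      by (simp add: measure_le_0_iff)
    then have "AE \<omega> in S. \<omega> \<notin> N"
      by (simp add: P.prob_eq_0)
    moreover have "AE \<omega> in S. \<omega> \<in> space S"
      by simp
    ultimately show ?thesis
      by eventually_elim (auto simp: N_def E_def not_less)
  qed
  have "AE \<omega> in S. \<forall>m. \<exists>s. \<forall>n\<ge>s. g n \<omega> \<le> 1 / real (Suc m)"
    by (subst AE_all_countable) (intro allI null, simp)
  then show ?thesis
  proof eventually_elim
    case (elim \<omega>)
    show ?case
    proof (rule LIMSEQ_I)
      fix r :: real assume "r > 0"
      then obtain m where m: "1 / real (Suc m) < r"
        using nat_approx_posE by blast
      with elim obtain s where "\<And>n. n \<ge> s \<Longrightarrow> g n \<omega> \<le> 1 / real (Suc m)"
        by blast
      then show "\<exists>no. \<forall>n\<ge>no. norm (g n \<omega> - 0) < r"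
        using m g_nonneg[of _ \<omega>] by (intro exI[of _ s]) (auto intro: order_le_less_trans)
    qed
  qed
qed

text \<open>An occurrence of the event at time \<open>n\<close> is followed, with a fixed positive probability and
  independently of the past, by a future that is quiet from lag \<open>m\<close> on. A quiet future excludes every
  occurrence after \<open>n + m\<close>, since such an occurrence also bounds from below the term that starts
  at \<open>n + 1\<close>. So at most \<open>m + 1\<close> times \<open>n\<close> have both properties, and taking expectations bounds the
  sum of the probabilities.\<close>

lemma summable_stays_above_if_AE_tendsto_0:
  assumes g: "AE \<omega> in S. (\<lambda>n. g n \<omega>) \<longlonglongrightarrow> 0" and "x > 0"
  shows "summable (\<lambda>n. measure S {\<omega> \<in> space S. stays_above x n \<omega>})"
proof -
  have "(\<lambda>m. measure S {\<omega> \<in> space S. \<exists>j\<ge>m. x < g j \<omega>}) \<longlonglongrightarrow> 0"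
  proof (rule P.prob_tendsto_0_if_AE_eventually_not)
    show "AE \<omega> in S. eventually (\<lambda>m. \<not> (\<exists>j\<ge>m. x < g j \<omega>)) sequentially"
      using g
    proof eventually_elim
      case (elim \<omega>)
      from order_tendstoD(2)[OF this \<open>x > 0\<close>]
      obtain m where "\<And>j. j \<ge> m \<Longrightarrow> g j \<omega> < x"
        by (auto simp: eventually_sequentially)
      then show ?case
        unfolding eventually_sequentially by (meson not_less_iff_gr_or_eq order_trans)
    qed
  qed simp
  from order_tendstoD(2)[OF this, of 1]
  have "eventually (\<lambda>m. measure S {\<omega> \<in> space S. \<exists>j\<ge>m. x < g j \<omega>} < 1 \<and> m > 0) sequentially"
    by (intro eventually_conj eventually_gt_at_top) simp_all
  then obtain m where m: "measure S {\<omega> \<in> space S. \<exists>j\<ge>m. x < g j \<omega>} < 1" "m > 0"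
    by (auto simp: eventually_sequentially)
  define quiet where "quiet = (\<lambda>\<omega>. \<forall>j\<ge>m. g j \<omega> \<le> x)"
  have [measurable]: "Measurable.pred S quiet"
    unfolding quiet_def by measurable
  define p where "p = measure S {\<omega> \<in> space S. quiet \<omega>}"
  have "p = 1 - measure S {\<omega> \<in> space S. \<exists>j\<ge>m. x < g j \<omega>}"
    unfolding p_def
    by (subst P.prob_compl[symmetric]) (auto simp: quiet_def not_less intro!: arg_cong[where f = "measure S"])
  then have p: "p > 0"
    using m by simp
  define B where "B = (\<lambda>n. {\<omega> \<in> space S. stays_above x n \<omega> \<and> quiet (seq_shift (Suc n) \<omega>)})"
  have [measurable]: "B n \<in> sets S" for n
    unfolding B_def by measurable
  have int_B: "integrable S (indicator (B n) :: _ \<Rightarrow> real)" for n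
    by (rule integrable_real_indicator) (measurable, simp add: P.emeasure_eq_measure)
  have B: "measure S (B n) = measure S {\<omega> \<in> space S. stays_above x n \<omega>} * p" for n
    unfolding B_def p_def by (rule prob_conj_shift) (simp_all add: determined_stays_above)
  have gap: "n' \<le> n + m" if "\<omega> \<in> B n" "\<omega> \<in> B n'" for n n' \<omega>
  proof (rule ccontr)
    assume "\<not> n' \<le> n + m"
    then have n': "Suc n < n'" "n' - Suc n \<ge> m"
      using m(2) by auto
    then have "x < g (n' - Suc n) (seq_shift (Suc n) \<omega>)"
      using that(2) by (simp add: B_def stays_above_def)
    moreover have "g (n' - Suc n) (seq_shift (Suc n) \<omega>) \<le> x"
      using that(1) n' by (simp add: B_def quiet_def)
    ultimately show False by simp
  qed
  have count: "(\<Sum>n<N. indicator (B n) \<omega>) \<le> real (Suc m)" for N \<omega>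
  proof -
    define I where "I = {n. n < N \<and> \<omega> \<in> B n}"
    have "(\<Sum>n<N. indicator (B n) \<omega> :: real) = real (card ({..<N} \<inter> {n. \<omega> \<in> B n}))"
      by (simp add: indicator_def of_bool_def sum.If_cases)
    also have "{..<N} \<inter> {n. \<omega> \<in> B n} = I"
      by (auto simp: I_def)
    finally have "(\<Sum>n<N. indicator (B n) \<omega> :: real) = real (card I)" .
    moreover have "card I \<le> Suc m"
    proof (cases "I = {}")
      case False
      then have "Min I \<in> I"
        by (intro Min_in) (auto simp: I_def)
      then have "I \<subseteq> {Min I..Min I + m}"
        using gap by (auto simp: I_def intro!: Min_le)
      from card_mono[OF _ this] show ?thesis by simp
    qed simp
    ultimately show ?thesis by simp
  qed
  have "(\<Sum>n<N. norm (measure S {\<omega> \<in> space S. stays_above x n \<omega>})) \<le> real (Suc m) / p" for N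
  proof -
    have "(\<Sum>n<N. measure S {\<omega> \<in> space S. stays_above x n \<omega>}) * p = (\<Sum>n<N. measure S (B n))"
      by (simp add: B sum_distrib_right)
    also have "\<dots> = (\<Sum>n<N. \<integral>\<omega>. indicator (B n) \<omega> \<partial>S)"
      by simp
    also have "\<dots> = (\<integral>\<omega>. (\<Sum>n<N. indicator (B n) \<omega>) \<partial>S)"
      by (rule Bochner_Integration.integral_sum[symmetric]) (rule int_B)
    also have "\<dots> \<le> (\<integral>\<omega>. real (Suc m) \<partial>S)"
      by (intro integral_mono count Bochner_Integration.integrable_sum int_B) simp
    finally show ?thesis
      using p by (simp add: P.prob_space field_simps)
  qed
  then have "summable (\<lambda>n. norm (measure S {\<omega> \<in> space S. stays_above x n \<omega>}))"
    by (rule summableI_nonneg_bounded[rotated]) simp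
  then show ?thesis by simp
qed

text \<open>At time \<open>0\<close>, looking back from time \<open>j + 1\<close>, the term that ends there is at most \<open>x\<close> for the first
  time; the terms started later were all above \<open>x\<close>.\<close>

definition drops_below :: "real \<Rightarrow> nat \<Rightarrow> (nat \<Rightarrow> 'a) \<Rightarrow> bool" where
  "drops_below x j \<omega> \<longleftrightarrow> stays_above x j (seq_shift 1 \<omega>) \<and> \<not> stays_above x (Suc j) \<omega>"

lemma measurable_drops_below [measurable]: "Measurable.pred S (drops_below x j)"
  unfolding drops_below_def by measurable

text \<open>If the terms ending at time \<open>j + 1\<close> are above \<open>x\<close> for all \<open>j + 1\<close> starting times, they are so for
  the last \<open>j\<close> of these, and by stationarity the latter event has the probability of
  \<open>stays_above x j\<close>. So the summands are differences of consecutive terms of one sequence of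
  probabilities.\<close>

lemma sum_prob_drops_below_le_1:
  "(\<Sum>j<n. measure S {\<omega> \<in> space S. drops_below x j \<omega>}) \<le> 1"
proof -
  define a where "a = (\<lambda>j. measure S {\<omega> \<in> space S. stays_above x j \<omega>})"
  have "measure S {\<omega> \<in> space S. drops_below x j \<omega>} = a j - a (Suc j)" for j
  proof -
    have sub: "stays_above x j (seq_shift 1 \<omega>)" if "stays_above x (Suc j) \<omega>" for \<omega>
      unfolding stays_above_def
    proof (intro allI impI)
      fix k assume "k < j"
      then show "x < g (j - k) (seq_shift k (seq_shift 1 \<omega>))"
        using that[unfolded stays_above_def, rule_format, of "Suc k"] by simp
    qed
    have "{\<omega> \<in> space S. drops_below x j \<omega>} = {\<omega> \<in> space S. stays_above x j (seq_shift 1 \<omega>)}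
        - {\<omega> \<in> space S. stays_above x (Suc j) \<omega>}"
      by (auto simp: drops_below_def)
    also have "measure S \<dots> = measure S {\<omega> \<in> space S. stays_above x j (seq_shift 1 \<omega>)} - a (Suc j)"
      unfolding a_def by (rule P.finite_measure_Diff) (use sub in auto)
    also have "measure S {\<omega> \<in> space S. stays_above x j (seq_shift 1 \<omega>)} = a j"
      unfolding a_def by (rule prob_shift) simp
    finally show ?thesis .
  qed
  then have "(\<Sum>j<n. measure S {\<omega> \<in> space S. drops_below x j \<omega>}) = a 0 - a n"
    by (simp add: sum_lessThan_telescope')
  also have "\<dots> \<le> 1"
    unfolding a_def using P.prob_le_1[of "{\<omega> \<in> space S. stays_above x 0 \<omega>}"]
      measure_nonneg[of S "{\<omega> \<in> space S. stays_above x n \<omega>}"] by linarith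
  finally show ?thesis .
qed

text \<open>Exactly one \<open>k\<close> contributes, namely the last starting time from which the term that ends at \<open>n\<close> is at
  most \<open>x\<close>; then \<open>g n \<omega> \<le> q k \<omega> * x\<close>. The sum over all \<open>k\<close> replaces the choice of that time, so that
  past and future separate in each summand.\<close>

lemma term_le_sum_over_drops:
  assumes "0 \<le> x" "\<not> stays_above x n \<omega>"
  shows "g n \<omega> \<le> x * (\<Sum>k<n. q k \<omega> * of_bool (drops_below x (n - k - 1) (seq_shift k \<omega>)))"
proof -
  define K where "K = {k. k < n \<and> g (n - k) (seq_shift k \<omega>) \<le> x}"
  have "finite K"
    by (simp add: K_def)
  obtain i where "i < n" "\<not> x < g (n - i) (seq_shift i \<omega>)"
    using assms(2) unfolding stays_above_def by blast
  then have "i \<in> K"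
    by (simp add: K_def)
  then have "K \<noteq> {}"
    by blast
  define k where "k = Max K"
  have "k \<in> K"
    unfolding k_def using \<open>finite K\<close> \<open>K \<noteq> {}\<close> by (rule Max_in)
  then have k: "k < n" "g (n - k) (seq_shift k \<omega>) \<le> x"
    by (auto simp: K_def)
  have above: "x < g (n - i) (seq_shift i \<omega>)" if "k < i" "i < n" for i
  proof (rule ccontr)
    assume "\<not> x < g (n - i) (seq_shift i \<omega>)"
    then have "i \<in> K" using that by (simp add: K_def)
    then have "i \<le> k"
      unfolding k_def using \<open>finite K\<close> by simp
    then show False using that by simp
  qed
  have "stays_above x (n - k - 1) (seq_shift 1 (seq_shift k \<omega>))"
    unfolding stays_above_def
  proof (intro allI impI)
    fix i assume i: "i < n - k - 1"
    have "n - (k + 1 + i) = n - k - 1 - i" by simp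
    then show "x < g (n - k - 1 - i) (seq_shift i (seq_shift 1 (seq_shift k \<omega>)))"
      using above[of "k + 1 + i"] i by (simp add: ac_simps)
  qed
  moreover have "\<not> stays_above x (Suc (n - k - 1)) (seq_shift k \<omega>)"
    using k unfolding stays_above_def by (auto simp: not_less dest!: spec[of _ 0])
  ultimately have drop: "drops_below x (n - k - 1) (seq_shift k \<omega>)"
    by (simp add: drops_below_def)
  have "g n \<omega> \<le> q k \<omega> * g (n - k) (seq_shift k \<omega>)"
    using g_submult[of k "n - k" \<omega>] k(1) by simp
  also have "\<dots> \<le> q k \<omega> * x"
    using k(2) q_nonneg by (intro mult_left_mono)
  also have "\<dots> = x * (q k \<omega> * of_bool (drops_below x (n - k - 1) (seq_shift k \<omega>)))"
    using drop by simp
  also have "\<dots> \<le> x * (\<Sum>k<n. q k \<omega> * of_bool (drops_below x (n - k - 1) (seq_shift k \<omega>)))"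
    using k(1) assms(1) q_nonneg
    by (intro mult_left_mono member_le_sum[where f = "\<lambda>k. q k \<omega> * of_bool (drops_below x (n - k - 1) (seq_shift k \<omega>))"])
      auto
  finally show ?thesis .
qed

definition drop_sum :: "real \<Rightarrow> real \<Rightarrow> nat \<Rightarrow> (nat \<Rightarrow> 'a) \<Rightarrow> real" where
  "drop_sum x L n \<omega> = (\<Sum>k<n. capped L k \<omega> * of_bool (drops_below x (n - k - 1) (seq_shift k \<omega>)))"

lemma drop_sum_nonneg: "0 \<le> drop_sum x L n \<omega>"
  by (auto simp: drop_sum_def capped_nonneg intro!: sum_nonneg)

lemma integrable_capped_drop:
  assumes "0 \<le> L"
  shows "integrable S (\<lambda>\<omega>. capped L k \<omega> * of_bool (drops_below x j (seq_shift k \<omega>)))"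
proof (rule P.integrable_const_bound[where B = L])
  show "AE \<omega> in S. norm (capped L k \<omega> * of_bool (drops_below x j (seq_shift k \<omega>))) \<le> L"
    using assms by (simp add: capped_nonneg capped_le)
qed measurable

lemma integrable_drop_sum: "0 \<le> L \<Longrightarrow> integrable S (drop_sum x L n)"
  unfolding drop_sum_def by (intro Bochner_Integration.integrable_sum integrable_capped_drop)

text \<open>By independence the left side is the partial sum of a convolution of the means of \<open>capped L\<close> with the
  probabilities of \<open>drops_below\<close>, whose total mass is at most \<open>1\<close>.\<close>

lemma sum_integral_drop_sum_le:
  assumes "0 \<le> L"
  shows "(\<Sum>n<N. \<integral>\<omega>. drop_sum x L n \<omega> \<partial>S) \<le> (\<Sum>n<N. \<integral>\<omega>. capped L n \<omega> \<partial>S)"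
proof (cases N)
  case (Suc m)
  define a where "a = (\<lambda>k. \<integral>\<omega>. capped L k \<omega> \<partial>S)"
  define d where "d = (\<lambda>j. measure S {\<omega> \<in> space S. drops_below x j \<omega>})"
  have a: "0 \<le> a k" for k
    unfolding a_def by (intro integral_nonneg_AE) (simp add: capped_nonneg)
  have d: "(\<integral>\<omega>. of_bool (drops_below x j \<omega>) \<partial>S) = d j" for j
    unfolding d_def by (rule prob_eq_integral_of_bool[symmetric]) simp
  have "(\<integral>\<omega>. drop_sum x L n \<omega> \<partial>S) = (\<Sum>k<n. a k * d (n - k - 1))" for n
  proof -
    have "(\<integral>\<omega>. drop_sum x L n \<omega> \<partial>S)
      = (\<Sum>k<n. \<integral>\<omega>. capped L k \<omega> * of_bool (drops_below x (n - k - 1) (seq_shift k \<omega>)) \<partial>S)"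
      unfolding drop_sum_def by (intro Bochner_Integration.integral_sum integrable_capped_drop assms)
    also have "\<dots> = (\<Sum>k<n. a k * d (n - k - 1))"
      unfolding a_def d[symmetric]
      by (intro sum.cong refl integral_mult_shift determined_capped) (simp_all add: capped_nonneg)
    finally show ?thesis .
  qed
  \<comment> \<open>A drop needs at least one step, so the sum for \<open>n = 0\<close> is empty and the triangle
    \<open>k + j < m\<close> has \<open>m = N - 1\<close>.\<close>
  then have "(\<Sum>n<N. \<integral>\<omega>. drop_sum x L n \<omega> \<partial>S) = (\<Sum>n<m. \<Sum>k\<le>n. a k * d (n - k))"
    unfolding Suc sum.lessThan_Suc_shift by (simp add: lessThan_Suc_atMost)
  also have "\<dots> = (\<Sum>(k, j) \<in> {(k, j). k + j < m}. a k * d j)"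
    by (rule sum.triangle_reindex[symmetric])
  also have "\<dots> \<le> (\<Sum>(k, j) \<in> {..<m} \<times> {..<m}. a k * d j)"
    by (rule sum_mono2) (auto simp: a d_def)
  also have "\<dots> = (\<Sum>k<m. a k * (\<Sum>j<m. d j))"
    by (simp add: sum.cartesian_product sum_distrib_left)
  also have "\<dots> \<le> (\<Sum>k<m. a k * 1)"
    using a sum_prob_drops_below_le_1 unfolding d_def by (intro sum_mono mult_left_mono) auto
  also have "\<dots> \<le> (\<Sum>k<N. a k)"
    using a Suc by simp
  finally show ?thesis
    by (simp add: a_def)
qed simp

end

text \<open>With \<open>g = q\<close> and \<open>x = 1/2\<close> the means \<open>a\<^sub>n\<close> of \<open>capped L n\<close> satisfy
  \<open>a\<^sub>0 + \<cdots> + a\<^bsub>N-1\<^esub> \<le> C + (a\<^sub>0 + \<cdots> + a\<^bsub>N-1\<^esub>) / 2\<close>, where \<open>C\<close> is \<open>L\<close> times the series of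
  condition (vi) for \<open>q\<close>. That series converges since \<open>q\<close> tends to \<open>0\<close>. The cap makes the sums
  finite, so that they can be subtracted.\<close>

lemma (in contracting_sequence) summable_integral_capped:
  assumes "0 \<le> L"
  shows "summable (\<lambda>n. \<integral>\<omega>. capped L n \<omega> \<partial>S)"
proof -
  interpret self: contracted_terms M q q
    by unfold_locales
      (auto intro: q_nonneg q_submult determined_by_first_mono[OF q_determined])
  define b where "b = (\<lambda>n. measure S {\<omega> \<in> space S. self.stays_above (1/2) n \<omega>})"
  have "summable b"
    unfolding b_def by (rule self.summable_stays_above_if_AE_tendsto_0[OF q_tendsto_0]) simp
  define a where "a = (\<lambda>n. \<integral>\<omega>. capped L n \<omega> \<partial>S)"
  have a: "0 \<le> a n" for n
    unfolding a_def by (intro integral_nonneg_AE) (simp add: capped_nonneg)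
  have step: "a n \<le> L * b n + (1/2) * (\<integral>\<omega>. self.drop_sum (1/2) L n \<omega> \<partial>S)" for n
  proof -
    define A where "A = {\<omega> \<in> space S. self.stays_above (1/2) n \<omega>}"
    have A [measurable]: "A \<in> sets S" unfolding A_def by measurable
    have intA: "integrable S (indicator A :: _ \<Rightarrow> real)"
      by (rule integrable_real_indicator) (measurable, simp add: P.emeasure_eq_measure)
    have "a n \<le> (\<integral>\<omega>. L * indicator A \<omega> + (1/2) * self.drop_sum (1/2) L n \<omega> \<partial>S)"
      unfolding a_def
    proof (rule integral_mono)
      fix \<omega> assume "\<omega> \<in> space S"
      show "capped L n \<omega> \<le> L * indicator A \<omega> + (1/2) * self.drop_sum (1/2) L n \<omega>"
      proof (cases "self.stays_above (1/2) n \<omega>")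
        case True
        then show ?thesis
          using \<open>\<omega> \<in> space S\<close> capped_le[OF assms, of n \<omega>] self.drop_sum_nonneg[of "1/2" L n \<omega>]
          by (simp add: A_def)
      next
        case False
        show ?thesis
        proof (cases "\<forall>i\<le>n. q i \<omega> \<le> L")
          case True
          then have "capped L k \<omega> = q k \<omega>" if "k \<le> n" for k
            using that unfolding capped_def by auto
          moreover have "q n \<omega> \<le> 1/2 * (\<Sum>k<n. q k \<omega> * of_bool (self.drops_below (1/2) (n - k - 1) (seq_shift k \<omega>)))"
            using False by (intro self.term_le_sum_over_drops) simp_all
          ultimately show ?thesis
            using assms by (simp add: self.drop_sum_def A_def False)
        next
          case False
          then show ?thesis
            using assms self.drop_sum_nonneg[of "1/2" L n \<omega>] unfolding capped_def by auto
        qed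
      qed
    qed (use assms intA in \<open>auto intro!: integrable_capped self.integrable_drop_sum\<close>)
    also have "\<dots> = L * (\<integral>\<omega>. indicator A \<omega> \<partial>S) + (1/2) * (\<integral>\<omega>. self.drop_sum (1/2) L n \<omega> \<partial>S)"
      using assms intA self.integrable_drop_sum by (subst Bochner_Integration.integral_add) auto
    also have "(\<integral>\<omega>. indicator A \<omega> \<partial>S) = measure S (A \<inter> space S)"
      by simp
    also have "A \<inter> space S = A"
      by (auto simp: A_def)
    finally show ?thesis
      by (simp add: b_def A_def)
  qed
  have "(\<Sum>n<N. norm (a n)) \<le> 2 * L * suminf b" for N
  proof -
    have "(\<Sum>n<N. a n) \<le> (\<Sum>n<N. L * b n + (1/2) * (\<integral>\<omega>. self.drop_sum (1/2) L n \<omega> \<partial>S))"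
      by (intro sum_mono step)
    also have "\<dots> = L * (\<Sum>n<N. b n) + (1/2) * (\<Sum>n<N. \<integral>\<omega>. self.drop_sum (1/2) L n \<omega> \<partial>S)"
      by (simp add: sum.distrib sum_distrib_left)
    also have "\<dots> \<le> L * suminf b + (1/2) * (\<Sum>n<N. a n)"
      unfolding a_def using assms \<open>summable b\<close>
      by (intro add_mono mult_left_mono self.sum_integral_drop_sum_le sum_le_suminf) (auto simp: b_def)
    finally show ?thesis
      using a by simp
  qed
  then have "summable (\<lambda>n. norm (a n))"
    by (rule summableI_nonneg_bounded[rotated]) simp
  then show ?thesis
    using a by (simp add: a_def)
qed

lemma AE_summable_if_summable_integral:
  fixes f :: "nat \<Rightarrow> 'a \<Rightarrow> real"
  assumes int: "\<And>n. integrable M (f n)" and nonneg: "\<And>n x. 0 \<le> f n x"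
    and sum: "summable (\<lambda>n. \<integral>x. f n x \<partial>M)"
  shows "AE x in M. summable (\<lambda>n. f n x)"
proof -
  have [measurable]: "f n \<in> borel_measurable M" for n
    using int by auto
  have "(\<integral>\<^sup>+x. (\<Sum>n. ennreal (f n x)) \<partial>M) = (\<Sum>n. \<integral>\<^sup>+x. ennreal (f n x) \<partial>M)"
    by (rule nn_integral_suminf) simp
  also have "\<dots> = (\<Sum>n. ennreal (\<integral>x. f n x \<partial>M))"
    by (simp add: nn_integral_eq_integral int nonneg)
  also have "\<dots> \<noteq> \<infinity>"
    by (simp add: suminf_ennreal2 sum nonneg)
  finally have "AE x in M. (\<Sum>n. ennreal (f n x)) \<noteq> \<infinity>"
    by (intro nn_integral_noteq_infinite) simp_all
  then show ?thesis
    by eventually_elim (auto intro!: summable_suminf_not_top nonneg)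
qed

text \<open>By Borel and Cantelli, \<open>g n\<close> is eventually at most \<open>x\<close> times the sum in \<open>term_le_sum_over_drops\<close>. On a
  path where \<open>q\<close> is at most \<open>L\<close>, this sum is \<open>drop_sum x L n\<close>, and the means of the latter are
  summable.\<close>

lemma (in contracted_terms) AE_summable_if_summable_stays_above:
  assumes "0 < x" and sum: "summable (\<lambda>n. measure S {\<omega> \<in> space S. stays_above x n \<omega>})"
  shows "AE \<omega> in S. summable (\<lambda>n. g n \<omega>)"
proof -
  have "AE \<omega> in S. summable (\<lambda>n. drop_sum x (real L) n \<omega>)" for L
  proof (rule AE_summable_if_summable_integral)
    have "(\<Sum>n<N. norm (\<integral>\<omega>. drop_sum x (real L) n \<omega> \<partial>S)) \<le> (\<Sum>n. \<integral>\<omega>. capped (real L) n \<omega> \<partial>S)" for N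
    proof -
      have "(\<Sum>n<N. norm (\<integral>\<omega>. drop_sum x (real L) n \<omega> \<partial>S)) = (\<Sum>n<N. \<integral>\<omega>. drop_sum x (real L) n \<omega> \<partial>S)"
        by (simp add: integral_nonneg_AE drop_sum_nonneg)
      also have "\<dots> \<le> (\<Sum>n<N. \<integral>\<omega>. capped (real L) n \<omega> \<partial>S)"
        by (rule sum_integral_drop_sum_le) simp
      also have "\<dots> \<le> (\<Sum>n. \<integral>\<omega>. capped (real L) n \<omega> \<partial>S)"
        by (intro sum_le_suminf summable_integral_capped)
          (auto intro!: integral_nonneg_AE simp: capped_nonneg)
      finally show ?thesis .
    qed
    then have "summable (\<lambda>n. norm (\<integral>\<omega>. drop_sum x (real L) n \<omega> \<partial>S))"
      by (rule summableI_nonneg_bounded[rotated]) simp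
    then show "summable (\<lambda>n. \<integral>\<omega>. drop_sum x (real L) n \<omega> \<partial>S)"
      by (rule summable_norm_cancel)
  qed (simp_all add: integrable_drop_sum drop_sum_nonneg)
  then have "AE \<omega> in S. \<forall>L. summable (\<lambda>n. drop_sum x (real L) n \<omega>)"
    by (simp add: AE_all_countable)
  moreover have "AE \<omega> in S. eventually (\<lambda>n. \<omega> \<in> space S - {\<omega> \<in> space S. stays_above x n \<omega>}) sequentially"
    by (rule borel_cantelli_AE1) (use sum in \<open>simp_all add: less_top[symmetric]\<close>)
  ultimately show ?thesis
    using q_tendsto_0
  proof eventually_elim
    case (elim \<omega>)
    have "Bseq (\<lambda>n. q n \<omega>)"
      using elim(3) by (rule convergent_imp_Bseq[OF convergentI])
    then obtain B where B: "\<And>n. norm (q n \<omega>) \<le> B"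
      by (metis BseqE)
    obtain L where "B \<le> real L"
      using real_arch_simple by blast
    then have "q n \<omega> \<le> real L" for n
      using B[of n] by simp
    then have capped: "capped (real L) n \<omega> = q n \<omega>" for n
      unfolding capped_def by auto
    have "eventually (\<lambda>n. norm (g n \<omega>) \<le> x * drop_sum x (real L) n \<omega>) sequentially"
      using elim(2)
    proof eventually_elim
      case (elim n)
      then show ?case
        using term_le_sum_over_drops[of x n \<omega>] \<open>0 < x\<close> g_nonneg[of n \<omega>]
        by (simp add: drop_sum_def capped)
    qed
    moreover have "summable (\<lambda>n. x * drop_sum x (real L) n \<omega>)"
      using elim(1) by (intro summable_mult) simp
    ultimately show ?case
      by (rule summable_comparison_test_ev)
  qed
qed

section \<open>The spectral norm and products of matrices\<close>

lemma borel_measurable_matrix_mult [measurable (raw)]: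
  fixes f :: "'w \<Rightarrow> real ^ 'n ^ 'm" and g :: "'w \<Rightarrow> real ^ 'k ^ 'n"
  assumes "f \<in> borel_measurable N" "g \<in> borel_measurable N"
  shows "(\<lambda>x. f x ** g x) \<in> borel_measurable N"
  using assms
  by (rule borel_measurable_continuous_Pair)
    (auto simp: matrix_matrix_mult_def intro!: continuous_intros)

lemma borel_measurable_matrix_vector_mult [measurable (raw)]:
  fixes f :: "'w \<Rightarrow> real ^ 'n ^ 'm" and g :: "'w \<Rightarrow> real ^ 'n"
  assumes "f \<in> borel_measurable N" "g \<in> borel_measurable N"
  shows "(\<lambda>x. f x *v g x) \<in> borel_measurable N"
  using assms
  by (rule borel_measurable_continuous_Pair)
    (auto simp: matrix_vector_mult_def intro!: continuous_intros)

lemma spectral_norm_nonneg: "0 \<le> spectral_norm A"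
  unfolding spectral_norm_def by (rule onorm_pos_le) simp

lemma norm_matrix_vector_mult_le: "norm (A *v v) \<le> spectral_norm A * norm v"
  unfolding spectral_norm_def by (rule onorm) simp

lemma spectral_norm_mult_le: "spectral_norm (A ** B) \<le> spectral_norm A * spectral_norm B"
proof -
  have "(*v) (A ** B) = (*v) A \<circ> (*v) B"
    by (auto simp: matrix_vector_mul_assoc)
  then show ?thesis
    unfolding spectral_norm_def by (simp add: onorm_compose)
qed

text \<open>The spectral norms of two matrices differ by at most the sum of the absolute values of the entries
  of their difference. Continuity is wanted for measurability.\<close>

lemma continuous_on_spectral_norm: "continuous_on UNIV spectral_norm"
  unfolding continuous_on_def
proof safe
  fix A :: "real ^ 'd ^ 'd"
  define r where "r = (\<lambda>B :: real ^ 'd ^ 'd. \<Sum>i\<in>UNIV. \<Sum>j\<in>UNIV. \<bar>(B - A) $ i $ j\<bar>)"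
  have diff: "spectral_norm B \<le> spectral_norm C + (\<Sum>i\<in>UNIV. \<Sum>j\<in>UNIV. \<bar>(B - C) $ i $ j\<bar>)"
    for B C :: "real ^ 'd ^ 'd"
  proof -
    have "(*v) B = (\<lambda>x. C *v x + (B - C) *v x)"
      by (simp add: matrix_vector_mult_diff_rdistrib)
    then have "spectral_norm B \<le> spectral_norm C + spectral_norm (B - C)"
      unfolding spectral_norm_def using onorm_triangle[of "(*v) C" "(*v) (B - C)"] by simp
    then show ?thesis
      using onorm_le_matrix_component_sum[of "B - C"] unfolding spectral_norm_def by linarith
  qed
  have "(r \<longlongrightarrow> r A) (at A)"
    unfolding r_def by (intro tendsto_intros)
  then have "(r \<longlongrightarrow> 0) (at A)"
    by (simp add: r_def)
  moreover have "norm (spectral_norm B - spectral_norm A) \<le> r B" for B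
    using diff[of B A] diff[of A B] by (simp add: r_def abs_minus_commute)
  ultimately show "(spectral_norm \<longlongrightarrow> spectral_norm A) (at A)"
    by (intro Lim_transform_bound[where f = "\<lambda>B. spectral_norm B - spectral_norm A" and g = r, THEN LIM_zero_cancel])
      (auto intro!: always_eventually intro: order_trans[OF _ abs_ge_self])
qed

lemma borel_measurable_spectral_norm [measurable]: "spectral_norm \<in> borel_measurable borel"
  by (rule borel_measurable_continuous_onI[OF continuous_on_spectral_norm])

text \<open>A sequence of pairs is indexed from \<open>0\<close> here: its entry \<open>i\<close> stands for \<open>(M\<^bsub>i+1\<^esub>, Z\<^bsub>i+1\<^esub>)\<close>.\<close>

definition left_product :: "nat \<Rightarrow> (nat \<Rightarrow> (real ^ 'd ^ 'd) \<times> 'b) \<Rightarrow> real ^ 'd ^ 'd" where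
  "left_product n \<omega> = foldr (**) (map (\<lambda>i. fst (\<omega> i)) [0..<n]) (mat 1)"

lemma left_product_0 [simp]: "left_product 0 \<omega> = mat 1"
  by (simp add: left_product_def)

lemma left_product_Suc: "left_product (Suc n) \<omega> = fst (\<omega> 0) ** left_product n (seq_shift 1 \<omega>)"
  by (simp add: left_product_def seq_shift_def upt_conv_Cons map_Suc_upt[symmetric] o_def
      del: upt_Suc map_Suc_upt)

lemma left_product_add:
  "left_product (k + n) \<omega> = left_product k \<omega> ** left_product n (seq_shift k \<omega>)"
  by (induction k arbitrary: \<omega>) (simp_all add: left_product_Suc matrix_mul_assoc)

lemma left_product_Suc_right: "left_product (Suc n) \<omega> = left_product n \<omega> ** fst (\<omega> n)"
  using left_product_add[of n 1 \<omega>] by (simp add: left_product_Suc seq_shift_def)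

lemma mat_prod_eq_left_product:
  "mat_prod (\<lambda>j. fst (\<omega> (j - 1))) (Suc k) n = left_product (n - k) (seq_shift k \<omega>)"
proof -
  have "[Suc k..<Suc n] = map (\<lambda>i. Suc k + i) [0..<n - k]"
    by (rule nth_equalityI) (simp_all del: upt_Suc)
  then show ?thesis
    unfolding mat_prod_def left_product_def seq_shift_def by (simp add: o_def)
qed

lemma mat_prod_cong:
  assumes "\<And>j. m \<le> j \<Longrightarrow> j \<le> n \<Longrightarrow> A j = B j"
  shows "mat_prod A m n = mat_prod B m n"
proof -
  have "map A [m..<Suc n] = map B [m..<Suc n]"
    using assms by (intro map_cong) auto
  then show ?thesis by (simp only: mat_prod_def)
qed

lemma determined_left_product: "determined_by_first n (left_product n)"
  unfolding determined_by_first_def left_product_def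
  by (auto intro!: arg_cong[where f = "\<lambda>xs. foldr (**) xs (mat 1)"])

section \<open>Forward iteration and backward iteration\<close>

definition perpetuity_sum :: "nat \<Rightarrow> (nat \<Rightarrow> (real ^ 'd ^ 'd) \<times> (real ^ 'd)) \<Rightarrow> real ^ 'd" where
  "perpetuity_sum n \<omega> = (\<Sum>i<n. left_product i \<omega> *v snd (\<omega> i))"

text \<open>With the affine maps \<open>f\<^sub>i v = M\<^sub>i v + Z\<^sub>i\<close>, \<open>backward n z\<close> is \<open>f\<^sub>1 (f\<^sub>2 (\<dots> (f\<^sub>n z)))\<close>, whereas \<open>forward n z\<close>
  is \<open>f\<^sub>n (\<dots> (f\<^sub>2 (f\<^sub>1 z)))\<close>. The former has converging paths, the latter is the recursion of the theorem.\<close>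

definition backward :: "nat \<Rightarrow> real ^ 'd \<Rightarrow> (nat \<Rightarrow> (real ^ 'd ^ 'd) \<times> (real ^ 'd)) \<Rightarrow> real ^ 'd" where
  "backward n z \<omega> = perpetuity_sum n \<omega> + left_product n \<omega> *v z"

primrec forward :: "nat \<Rightarrow> real ^ 'd \<Rightarrow> (nat \<Rightarrow> (real ^ 'd ^ 'd) \<times> (real ^ 'd)) \<Rightarrow> real ^ 'd" where
  "forward 0 z \<omega> = z"
| "forward (Suc n) z \<omega> = fst (\<omega> n) *v forward n z \<omega> + snd (\<omega> n)"

lemma perpetuity_sum_add:
  "perpetuity_sum (k + n) \<omega> = perpetuity_sum k \<omega> + left_product k \<omega> *v perpetuity_sum n (seq_shift k \<omega>)"
proof -
  have "perpetuity_sum (k + n) \<omega>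
      = perpetuity_sum k \<omega> + (\<Sum>i<n. left_product (k + i) \<omega> *v snd (\<omega> (k + i)))"
    unfolding perpetuity_sum_def by (induction n) (simp_all add: add.assoc)
  also have "(\<Sum>i<n. left_product (k + i) \<omega> *v snd (\<omega> (k + i)))
      = left_product k \<omega> *v perpetuity_sum n (seq_shift k \<omega>)"
    by (simp add: perpetuity_sum_def left_product_add matrix_vector_mul_assoc[symmetric]
        linear_sum[OF matrix_vector_mul_linear] seq_shift_def)
  finally show ?thesis .
qed

lemma backward_add:
  "backward (k + n) z \<omega> = perpetuity_sum k \<omega> + left_product k \<omega> *v backward n z (seq_shift k \<omega>)"
  by (simp add: backward_def perpetuity_sum_add left_product_add matrix_vector_right_distrib
      matrix_vector_mul_assoc add.assoc)

lemma determined_perpetuity_sum: "determined_by_first n (perpetuity_sum n)"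
  unfolding determined_by_first_def perpetuity_sum_def
proof (intro allI impI sum.cong refl)
  fix \<omega> \<omega>' :: "nat \<Rightarrow> (real ^ 'd ^ 'd) \<times> (real ^ 'd)" and i
  assume *: "\<forall>i<n. \<omega> i = \<omega>' i" "i \<in> {..<n}"
  then have "left_product i \<omega> = left_product i \<omega>'"
    by (intro determined_by_firstD[OF determined_left_product]) auto
  with * show "left_product i \<omega> *v snd (\<omega> i) = left_product i \<omega>' *v snd (\<omega>' i)"
    by auto
qed

lemma determined_backward: "determined_by_first n (backward n z)"
  using determined_perpetuity_sum[of n] determined_left_product[of n]
  unfolding determined_by_first_def backward_def by metis

definition reverse_first :: "nat \<Rightarrow> (nat \<Rightarrow> 'a) \<Rightarrow> nat \<Rightarrow> 'a" where
  "reverse_first n \<omega> = (\<lambda>i. \<omega> (if i < n then n - 1 - i else i))"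

text \<open>The outermost map of the recursion is the last one, which comes first in the reversed sequence.\<close>

lemma forward_eq_backward: "forward n z \<omega> = backward n z (reverse_first n \<omega>)"
proof (induction n)
  case 0
  then show ?case by (simp add: backward_def perpetuity_sum_def)
next
  case (Suc n)
  have "backward n z (seq_shift 1 (reverse_first (Suc n) \<omega>)) = backward n z (reverse_first n \<omega>)"
    by (rule determined_by_firstD[OF determined_backward]) (auto simp: seq_shift_def reverse_first_def)
  moreover have "reverse_first (Suc n) \<omega> 0 = \<omega> n"
    by (simp add: reverse_first_def)
  ultimately show ?case
    using backward_add[of 1 n z "reverse_first (Suc n) \<omega>"]
    by (simp add: Suc perpetuity_sum_def left_product_Suc add.commute)
qed

lemma (in sequence_space) distr_reverse_first: "distr S S (reverse_first n) = S"
proof -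
  define f where "f = (\<lambda>i. if i < n then n - 1 - i else i)"
  have "inj f"
    unfolding inj_def f_def by auto
  then show ?thesis
    using distr_PiM_reindex[of UNIV "\<lambda>_. M" f UNIV] M.prob_space_axioms
    by (simp add: reverse_first_def[abs_def] f_def restrict_UNIV)
qed

lemma (in sequence_space) measurable_reverse_first [measurable]: "reverse_first n \<in> S \<rightarrow>\<^sub>M S"
  unfolding reverse_first_def by (rule measurable_PiM_single') (simp_all add: space_PiM PiE_iff)

section \<open>Independent random affine maps\<close>

locale affine_sequence = sequence_space M for M :: "((real ^ 'd ^ 'd) \<times> (real ^ 'd)) measure" +
  assumes sets_M [measurable_cong]: "sets M = sets (borel \<Otimes>\<^sub>M borel)"
begin

lemma measurable_left_product [measurable]: "left_product n \<in> borel_measurable S"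
proof (induction n)
  case 0
  have "left_product 0 = (\<lambda>\<omega> :: nat \<Rightarrow> (real ^ 'd ^ 'd) \<times> (real ^ 'd). mat 1)"
    by auto
  then show ?case by simp
next
  case (Suc n)
  note [measurable] = Suc
  have "(\<lambda>\<omega>. left_product n \<omega> ** fst (\<omega> n)) \<in> borel_measurable S"
    by measurable
  then show ?case
    by (simp add: left_product_Suc_right[abs_def])
qed

lemma measurable_perpetuity_sum [measurable]: "perpetuity_sum n \<in> borel_measurable S"
  unfolding perpetuity_sum_def by measurable

end

locale contracting_affine_sequence = affine_sequence M
  for M :: "((real ^ 'd ^ 'd) \<times> (real ^ 'd)) measure" +
  assumes tendsto_0: "AE \<omega> in S. (\<lambda>n. spectral_norm (left_product n \<omega>)) \<longlonglongrightarrow> 0"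

sublocale contracting_affine_sequence \<subseteq> contracted_terms M
  "\<lambda>n \<omega>. spectral_norm (left_product n \<omega>)" "\<lambda>n \<omega>. norm (left_product n \<omega> *v snd (\<omega> n))"
proof
  show "determined_by_first n (\<lambda>\<omega>. spectral_norm (left_product n \<omega> :: real ^ 'd ^ 'd))" for n
    using determined_left_product unfolding determined_by_first_def by metis
  show "determined_by_first (Suc n) (\<lambda>\<omega>. norm (left_product n \<omega> *v snd (\<omega> n) :: real ^ 'd))" for n
    unfolding determined_by_first_def
  proof (intro allI impI)
    fix \<omega> \<omega>' :: "nat \<Rightarrow> (real ^ 'd ^ 'd) \<times> (real ^ 'd)"
    assume eq: "\<forall>i<Suc n. \<omega> i = \<omega>' i"
    then have "left_product n \<omega> = left_product n \<omega>'"
      by (intro determined_by_firstD[OF determined_left_product]) auto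
    with eq show "norm (left_product n \<omega> *v snd (\<omega> n)) = norm (left_product n \<omega>' *v snd (\<omega>' n))"
      by simp
  qed
  fix k n and \<omega> :: "nat \<Rightarrow> (real ^ 'd ^ 'd) \<times> (real ^ 'd)"
  show "spectral_norm (left_product (k + n) \<omega>)
      \<le> spectral_norm (left_product k \<omega>) * spectral_norm (left_product n (seq_shift k \<omega>))"
    by (simp add: left_product_add spectral_norm_mult_le)
  show "norm (left_product (k + n) \<omega> *v snd (\<omega> (k + n)))
      \<le> spectral_norm (left_product k \<omega>) * norm (left_product n (seq_shift k \<omega>) *v snd (seq_shift k \<omega> n))"
    by (simp add: left_product_add matrix_vector_mul_assoc[symmetric] seq_shift_def
        norm_matrix_vector_mult_le)
qed (use tendsto_0 in \<open>simp_all add: spectral_norm_nonneg\<close>)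

text \<open>The law of the initial value enters as a separate factor \<open>\<zeta>\<close> of the probability space.\<close>

locale started_affine_sequence = affine_sequence M + zeta: prob_space \<zeta>
  for M :: "((real ^ 'd ^ 'd) \<times> (real ^ 'd)) measure" and \<zeta> :: "(real ^ 'd) measure" +
  assumes sets_zeta [measurable_cong]: "sets \<zeta> = sets borel"
begin

lemma measurable_backward [measurable (raw)]:
  assumes [measurable]: "f \<in> borel_measurable N" "h \<in> N \<rightarrow>\<^sub>M S"
  shows "(\<lambda>x. backward n (f x) (h x)) \<in> borel_measurable N"
  unfolding backward_def by measurable

lemma measurable_forward [measurable (raw)]:
  assumes [measurable]: "f \<in> borel_measurable N" "h \<in> N \<rightarrow>\<^sub>M S"
  shows "(\<lambda>x. forward n (f x) (h x)) \<in> borel_measurable N"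
  unfolding forward_eq_backward by measurable

lemma distr_forward_eq_backward:
  "distr (\<zeta> \<Otimes>\<^sub>M S) borel (\<lambda>(z, \<omega>). forward n z \<omega>) = distr (\<zeta> \<Otimes>\<^sub>M S) borel (\<lambda>(z, \<omega>). backward n z \<omega>)"
proof -
  \<comment> \<open>Reversing the first \<open>n\<close> coordinates preserves the product measure and exchanges the two
    iterations.\<close>
  have "\<zeta> \<Otimes>\<^sub>M S = distr \<zeta> \<zeta> (\<lambda>z. z) \<Otimes>\<^sub>M distr S S (reverse_first n)"
    by (simp add: distr_reverse_first distr_id2)
  also have "\<dots> = distr (\<zeta> \<Otimes>\<^sub>M S) (\<zeta> \<Otimes>\<^sub>M S) (\<lambda>(z, \<omega>). (z, reverse_first n \<omega>))"
    by (rule pair_measure_distr)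
      (simp_all add: distr_reverse_first P.sigma_finite_measure_axioms)
  finally have "distr (\<zeta> \<Otimes>\<^sub>M S) borel (\<lambda>(z, \<omega>). backward n z \<omega>)
      = distr (distr (\<zeta> \<Otimes>\<^sub>M S) (\<zeta> \<Otimes>\<^sub>M S) (\<lambda>(z, \<omega>). (z, reverse_first n \<omega>))) borel (\<lambda>(z, \<omega>). backward n z \<omega>)"
    by simp
  also have "\<dots> = distr (\<zeta> \<Otimes>\<^sub>M S) borel (\<lambda>(z, \<omega>). forward n z \<omega>)"
    by (subst distr_distr) (auto simp: forward_eq_backward o_def case_prod_beta')
  finally show ?thesis by simp
qed

lemma measure_pair_eq_integral:
  assumes E: "Measurable.pred (\<zeta> \<Otimes>\<^sub>M S) (\<lambda>p. E (fst p) (snd p))"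
  shows "measure (\<zeta> \<Otimes>\<^sub>M S) {p \<in> space (\<zeta> \<Otimes>\<^sub>M S). E (fst p) (snd p)}
      = (\<integral>z. measure S {\<omega> \<in> space S. E z \<omega>} \<partial>\<zeta>)"
    and "integrable \<zeta> (\<lambda>z. measure S {\<omega> \<in> space S. E z \<omega>})"
proof -
  let ?A = "{p \<in> space (\<zeta> \<Otimes>\<^sub>M S). E (fst p) (snd p)}"
  have A: "?A \<in> sets (\<zeta> \<Otimes>\<^sub>M S)"
    using E by measurable
  have sec: "Pair z -` ?A = {\<omega> \<in> space S. E z \<omega>}" if "z \<in> space \<zeta>" for z
    using that by (auto simp: space_pair_measure)
  have "(\<lambda>z. measure S (Pair z -` ?A)) \<in> borel_measurable \<zeta>"
    using P.measurable_emeasure_Pair[OF A] unfolding measure_def by measurable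
  moreover have "(\<lambda>z. measure S {\<omega> \<in> space S. E z \<omega>}) \<in> borel_measurable \<zeta>
      \<longleftrightarrow> (\<lambda>z. measure S (Pair z -` ?A)) \<in> borel_measurable \<zeta>"
    by (intro measurable_cong arg_cong[where f = "measure S"] sec[symmetric])
  ultimately have meas: "(\<lambda>z. measure S {\<omega> \<in> space S. E z \<omega>}) \<in> borel_measurable \<zeta>"
    by (simp only:)
  then show int: "integrable \<zeta> (\<lambda>z. measure S {\<omega> \<in> space S. E z \<omega>})"
    by (intro zeta.integrable_const_bound[where B = 1]) simp_all
  have "emeasure (\<zeta> \<Otimes>\<^sub>M S) ?A = (\<integral>\<^sup>+z. emeasure S (Pair z -` ?A) \<partial>\<zeta>)"
    by (rule P.emeasure_pair_measure_alt[OF A])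
  also have "\<dots> = (\<integral>\<^sup>+z. ennreal (measure S {\<omega> \<in> space S. E z \<omega>}) \<partial>\<zeta>)"
    by (intro nn_integral_cong) (simp only: sec P.emeasure_eq_measure)
  also have "\<dots> = ennreal (\<integral>z. measure S {\<omega> \<in> space S. E z \<omega>} \<partial>\<zeta>)"
    by (rule nn_integral_eq_integral[OF int]) simp
  finally show "measure (\<zeta> \<Otimes>\<^sub>M S) ?A = (\<integral>z. measure S {\<omega> \<in> space S. E z \<omega>} \<partial>\<zeta>)"
    by (simp add: measure_def integral_nonneg_AE)
qed

section \<open>From tightness to bounded paths\<close>

text \<open>Let \<open>s\<close> be the first time at which \<open>perpetuity_sum s\<close> is longer than \<open>r + L * R\<close> while the product
  has norm at most \<open>L\<close>. By \<open>backward_add\<close>, \<open>backward n z\<close> differs from that sum by the product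
  applied to a vector that is independent of the first \<open>s\<close> coordinates and has length at most \<open>R\<close> with
  probability at least \<open>1 / 2\<close>; in this case \<open>backward n z\<close> is still longer than \<open>r\<close>. This is Ottaviani's
  inequality, with the bound on the norm included in the stopping rule because the
  increment after \<open>s\<close> is multiplied by the product up to \<open>s\<close>.\<close>

lemma maximal_inequality:
  fixes r L R :: real
  assumes "0 \<le> L" "0 \<le> R"
    and R: "\<And>n. measure (\<zeta> \<Otimes>\<^sub>M S) {p \<in> space (\<zeta> \<Otimes>\<^sub>M S). R < norm (backward n (fst p) (snd p))} \<le> 1 / 2"
  shows "measure S {\<omega> \<in> space S. \<exists>s\<le>n. r + L * R < norm (perpetuity_sum s \<omega>) \<and> spectral_norm (left_product s \<omega>) \<le> L}
    \<le> 2 * measure (\<zeta> \<Otimes>\<^sub>M S) {p \<in> space (\<zeta> \<Otimes>\<^sub>M S). r < norm (backward n (fst p) (snd p))}"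
proof -
  define F where "F = (\<lambda>s \<omega>. r + L * R < norm (perpetuity_sum s \<omega> :: real ^ 'd) \<and> spectral_norm (left_product s \<omega> :: real ^ 'd ^ 'd) \<le> L)"
  define H where "H = (\<lambda>s \<omega>. F s \<omega> \<and> (\<forall>i<s. \<not> F i \<omega>))"
  have [measurable]: "Measurable.pred S (F s)" for s
    unfolding F_def by measurable
  have [measurable]: "Measurable.pred S (H s)" for s
    unfolding H_def by measurable
  have F_det: "F i \<omega> = F i \<omega>'" if "\<forall>j<s. \<omega> j = \<omega>' j" "i \<le> s" for i s \<omega> \<omega>'
    using that determined_by_firstD[OF determined_perpetuity_sum, of i \<omega> \<omega>']
      determined_by_firstD[OF determined_left_product, of i \<omega> \<omega>']
    unfolding F_def by auto
  have H_det: "determined_by_first s (H s)" for s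
    unfolding determined_by_first_def
  proof (intro allI impI)
    fix \<omega> \<omega>' :: "nat \<Rightarrow> (real ^ 'd ^ 'd) \<times> (real ^ 'd)"
    assume "\<forall>j<s. \<omega> j = \<omega>' j"
    from F_det[OF this] show "H s \<omega> = H s \<omega>'"
      unfolding H_def by simp
  qed
  define c where "c = (\<lambda>u z. measure S {\<omega> \<in> space S. norm (backward u z \<omega>) \<le> R})"
  define t where "t = (\<lambda>z. measure S {\<omega> \<in> space S. r < norm (backward n z \<omega>)})"
  have int_c: "integrable \<zeta> (c u)"
    and c: "(\<integral>z. c u z \<partial>\<zeta>) \<ge> 1 / 2" for u
  proof -
    show "integrable \<zeta> (c u)"
      unfolding c_def by (rule measure_pair_eq_integral(2)) measurable
    interpret pair: prob_space "\<zeta> \<Otimes>\<^sub>M S"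
      by (rule prob_space_pair) unfold_locales
    have "(\<integral>z. c u z \<partial>\<zeta>) = measure (\<zeta> \<Otimes>\<^sub>M S) {p \<in> space (\<zeta> \<Otimes>\<^sub>M S). norm (backward u (fst p) (snd p)) \<le> R}"
      unfolding c_def by (rule measure_pair_eq_integral(1)[symmetric]) measurable
    also have "{p \<in> space (\<zeta> \<Otimes>\<^sub>M S). norm (backward u (fst p) (snd p)) \<le> R}
      = space (\<zeta> \<Otimes>\<^sub>M S) - {p \<in> space (\<zeta> \<Otimes>\<^sub>M S). R < norm (backward u (fst p) (snd p))}"
      by auto
    also have "measure (\<zeta> \<Otimes>\<^sub>M S) \<dots> = 1 - measure (\<zeta> \<Otimes>\<^sub>M S) {p \<in> space (\<zeta> \<Otimes>\<^sub>M S). R < norm (backward u (fst p) (snd p))}"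
      by (rule pair.prob_compl) measurable
    finally show "(\<integral>z. c u z \<partial>\<zeta>) \<ge> 1 / 2"
      using R[of u] by simp
  qed
  have int_t: "integrable \<zeta> t"
    and t: "(\<integral>z. t z \<partial>\<zeta>) = measure (\<zeta> \<Otimes>\<^sub>M S) {p \<in> space (\<zeta> \<Otimes>\<^sub>M S). r < norm (backward n (fst p) (snd p))}"
    unfolding t_def
    by (rule measure_pair_eq_integral(2), measurable) (rule measure_pair_eq_integral(1)[symmetric], measurable)
  have disj: "disjoint_family_on (\<lambda>s. {\<omega> \<in> space S. H s \<omega> \<and> Q s \<omega>}) {..n}" for Q
    unfolding disjoint_family_on_def H_def by (auto simp: neq_iff)
  define h where "h = (\<lambda>s. measure S {\<omega> \<in> space S. H s \<omega>})"
  have le_t: "(\<Sum>s\<le>n. h s * c (n - s) z) \<le> t z" if z: "z \<in> space \<zeta>" for z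
  proof -
    have [measurable]: "z \<in> space \<zeta>" by fact
    have "(\<Sum>s\<le>n. h s * c (n - s) z)
      = (\<Sum>s\<le>n. measure S {\<omega> \<in> space S. H s \<omega> \<and> norm (backward (n - s) z (seq_shift s \<omega>)) \<le> R})"
      unfolding h_def c_def by (intro sum.cong refl prob_conj_shift[symmetric] H_det) measurable
    also have "\<dots> = measure S (\<Union>s\<le>n. {\<omega> \<in> space S. H s \<omega> \<and> norm (backward (n - s) z (seq_shift s \<omega>)) \<le> R})"
      by (rule P.finite_measure_finite_Union[symmetric]) (use disj in auto)
    also have "\<dots> \<le> t z"
      unfolding t_def
    proof (rule P.finite_measure_mono)
      show "(\<Union>s\<le>n. {\<omega> \<in> space S. H s \<omega> \<and> norm (backward (n - s) z (seq_shift s \<omega>)) \<le> R})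
        \<subseteq> {\<omega> \<in> space S. r < norm (backward n z \<omega>)}"
      proof clarify
        fix s \<omega>
        assume s: "s \<le> n" "H s \<omega>" "norm (backward (n - s) z (seq_shift s \<omega>)) \<le> R"
        let ?y = "left_product s \<omega> *v backward (n - s) z (seq_shift s \<omega>)"
        have "norm ?y \<le> spectral_norm (left_product s \<omega>) * norm (backward (n - s) z (seq_shift s \<omega>))"
          by (rule norm_matrix_vector_mult_le)
        also have "\<dots> \<le> L * R"
          using s assms by (intro mult_mono) (auto simp: H_def F_def)
        finally have "r < norm (perpetuity_sum s \<omega>) - norm ?y"
          using s by (simp add: H_def F_def)
        also have "\<dots> \<le> norm (perpetuity_sum s \<omega> + ?y)"
          by (metis add.commute diff_add_cancel norm_diff_ineq)
        also have "\<dots> = norm (backward n z \<omega>)"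
          using backward_add[of s "n - s" z \<omega>] s(1) by simp
        finally show "r < norm (backward n z \<omega>)" .
      qed
    qed measurable
    finally show ?thesis .
  qed
  have "{\<omega> \<in> space S. \<exists>s\<le>n. F s \<omega>} = (\<Union>s\<le>n. {\<omega> \<in> space S. H s \<omega> \<and> True})"
  proof (intro subset_antisym subsetI)
    fix \<omega> assume "\<omega> \<in> {\<omega> \<in> space S. \<exists>s\<le>n. F s \<omega>}"
    then obtain s where s: "s \<le> n" "F s \<omega>" "\<omega> \<in> space S"
      by blast
    define i where "i = (LEAST i. F i \<omega>)"
    have "F i \<omega>"
      unfolding i_def by (rule LeastI[of "\<lambda>i. F i \<omega>", OF s(2)])
    moreover have "\<not> F j \<omega>" if "j < i" for j
      using that unfolding i_def by (rule not_less_Least)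
    ultimately have "H i \<omega>"
      unfolding H_def by blast
    moreover have "i \<le> n"
      unfolding i_def using Least_le[of "\<lambda>i. F i \<omega>", OF s(2)] s(1) by linarith
    ultimately show "\<omega> \<in> (\<Union>s\<le>n. {\<omega> \<in> space S. H s \<omega> \<and> True})"
      using s(3) by blast
  next
    fix \<omega> assume "\<omega> \<in> (\<Union>s\<le>n. {\<omega> \<in> space S. H s \<omega> \<and> True})"
    then show "\<omega> \<in> {\<omega> \<in> space S. \<exists>s\<le>n. F s \<omega>}"
      unfolding H_def by blast
  qed
  then have "measure S {\<omega> \<in> space S. \<exists>s\<le>n. F s \<omega>} = (\<Sum>s\<le>n. h s)"
    unfolding h_def using disj[of "\<lambda>_ _. True"]
    by (subst P.finite_measure_finite_Union[symmetric]) auto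
  also have "\<dots> = 2 * (\<Sum>s\<le>n. h s * (1 / 2))"
    by (simp add: sum_distrib_left)
  also have "\<dots> \<le> 2 * (\<Sum>s\<le>n. h s * (\<integral>z. c (n - s) z \<partial>\<zeta>))"
    using c by (intro mult_left_mono sum_mono) (auto simp: h_def)
  also have "(\<Sum>s\<le>n. h s * (\<integral>z. c (n - s) z \<partial>\<zeta>)) = (\<integral>z. (\<Sum>s\<le>n. h s * c (n - s) z) \<partial>\<zeta>)"
    using int_c by (subst Bochner_Integration.integral_sum) auto
  also have "\<dots> \<le> (\<integral>z. t z \<partial>\<zeta>)"
    using int_c int_t le_t by (intro integral_mono Bochner_Integration.integrable_sum) auto
  finally show ?thesis
    by (simp add: F_def t)
qed

text \<open>\<open>maximal_inequality\<close> with a fixed \<open>R\<close> and growing \<open>r\<close> bounds \<open>perpetuity_sum\<close> at all times at which the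
  product has norm at most \<open>L\<close>. On almost every path some \<open>L\<close> serves for all times, and the terms
  are differences of consecutive sums.\<close>

lemma AE_bounded_if_tight:
  assumes contr: "AE \<omega> in S. (\<lambda>n. spectral_norm (left_product n \<omega>)) \<longlonglongrightarrow> 0"
    and tight: "\<And>e. 0 < e \<Longrightarrow> \<exists>R. \<forall>n.
      measure (\<zeta> \<Otimes>\<^sub>M S) {p \<in> space (\<zeta> \<Otimes>\<^sub>M S). R < norm (backward n (fst p) (snd p))} \<le> e"
  shows "AE \<omega> in S. bdd_above (range (\<lambda>n. norm (left_product n \<omega> *v snd (\<omega> n))))"
proof -
  interpret pair: prob_space "\<zeta> \<Otimes>\<^sub>M S"
    by (rule prob_space_pair) unfold_locales
  have mono: "measure (\<zeta> \<Otimes>\<^sub>M S) {p \<in> space (\<zeta> \<Otimes>\<^sub>M S). R' < norm (backward n (fst p) (snd p))} \<le> e"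
    if "measure (\<zeta> \<Otimes>\<^sub>M S) {p \<in> space (\<zeta> \<Otimes>\<^sub>M S). R < norm (backward n (fst p) (snd p))} \<le> e" "R \<le> R'"
    for R R' n e
  proof -
    have "measure (\<zeta> \<Otimes>\<^sub>M S) {p \<in> space (\<zeta> \<Otimes>\<^sub>M S). R' < norm (backward n (fst p) (snd p))}
      \<le> measure (\<zeta> \<Otimes>\<^sub>M S) {p \<in> space (\<zeta> \<Otimes>\<^sub>M S). R < norm (backward n (fst p) (snd p))}"
      by (rule pair.finite_measure_mono) (use \<open>R \<le> R'\<close> in auto)
    then show ?thesis using that(1) by simp
  qed
  obtain R1 where R1:
    "\<And>n. measure (\<zeta> \<Otimes>\<^sub>M S) {p \<in> space (\<zeta> \<Otimes>\<^sub>M S). R1 < norm (backward n (fst p) (snd p))} \<le> 1 / 2"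
    using tight[of "1 / 2"] by auto
  define R where "R = max 0 R1"
  have R: "0 \<le> R"
    "\<And>n. measure (\<zeta> \<Otimes>\<^sub>M S) {p \<in> space (\<zeta> \<Otimes>\<^sub>M S). R < norm (backward n (fst p) (snd p))} \<le> 1 / 2"
    by (simp add: R_def) (rule mono[OF R1], simp add: R_def)
  define F where "F = (\<lambda>(L :: nat) (r :: nat) s \<omega>. real r + real L * R < norm (perpetuity_sum s \<omega> :: real ^ 'd)
      \<and> spectral_norm (left_product s \<omega> :: real ^ 'd ^ 'd) \<le> real L)"
  have [measurable]: "Measurable.pred S (F L r s)" for L r s
    unfolding F_def by measurable
  have "AE \<omega> in S. \<exists>r. \<forall>s. \<not> F L r s \<omega>" for L
  proof -
    define N where "N = {\<omega> \<in> space S. \<forall>r. \<exists>s. F L r s \<omega>}"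
    have [measurable]: "N \<in> sets S" unfolding N_def by measurable
    have "measure S N \<le> 0"
    proof (rule field_le_epsilon)
      fix e :: real assume "0 < e"
      then obtain R0 where R0:
        "\<And>n. measure (\<zeta> \<Otimes>\<^sub>M S) {p \<in> space (\<zeta> \<Otimes>\<^sub>M S). R0 < norm (backward n (fst p) (snd p))} \<le> e / 2"
        using tight[of "e / 2"] by auto
      obtain r :: nat where r: "R0 \<le> real r"
        using real_arch_simple by blast
      have "(\<lambda>n. measure S {\<omega> \<in> space S. \<exists>s\<le>n. F L r s \<omega>}) \<longlonglongrightarrow> measure S (\<Union>n. {\<omega> \<in> space S. \<exists>s\<le>n. F L r s \<omega>})"
        by (rule P.finite_Lim_measure_incseq) (auto simp: incseq_def intro: order_trans)
      moreover have "measure S {\<omega> \<in> space S. \<exists>s\<le>n. F L r s \<omega>} \<le> e" for n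
      proof -
        have "measure S {\<omega> \<in> space S. \<exists>s\<le>n. F L r s \<omega>}
          \<le> 2 * measure (\<zeta> \<Otimes>\<^sub>M S) {p \<in> space (\<zeta> \<Otimes>\<^sub>M S). real r < norm (backward n (fst p) (snd p))}"
          unfolding F_def by (rule maximal_inequality) (use R in auto)
        also have "\<dots> \<le> 2 * (e / 2)"
          by (intro mult_left_mono mono[OF R0 r]) simp
        finally show ?thesis by simp
      qed
      ultimately have "measure S (\<Union>n. {\<omega> \<in> space S. \<exists>s\<le>n. F L r s \<omega>}) \<le> e"
        by (intro LIMSEQ_le_const2) auto
      moreover have "measure S N \<le> measure S (\<Union>n. {\<omega> \<in> space S. \<exists>s\<le>n. F L r s \<omega>})"
        by (rule P.finite_measure_mono) (fastforce simp: N_def)+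
      ultimately show "measure S N \<le> 0 + e" by simp
    qed
    then have "measure S N = 0"
      by (simp add: measure_le_0_iff)
    then have "AE \<omega> in S. \<omega> \<notin> N"
      by (simp add: P.prob_eq_0)
    moreover have "AE \<omega> in S. \<omega> \<in> space S" by simp
    ultimately show ?thesis
      by eventually_elim (auto simp: N_def)
  qed
  then have "AE \<omega> in S. \<forall>L. \<exists>r. \<forall>s. \<not> F L r s \<omega>"
    by (simp add: AE_all_countable)
  then show ?thesis
    using contr
  proof eventually_elim
    case (elim \<omega>)
    have "Bseq (\<lambda>n. spectral_norm (left_product n \<omega>))"
      using elim(2) by (rule convergent_imp_Bseq[OF convergentI])
    then obtain B where B: "\<And>n. norm (spectral_norm (left_product n \<omega>)) \<le> B"
      by (metis BseqE)
    obtain L where "B \<le> real L"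
      using real_arch_simple by blast
    then have L: "spectral_norm (left_product n \<omega>) \<le> real L" for n
      using B[of n] by simp
    from elim(1) obtain r where "\<And>s. \<not> F L r s \<omega>" by blast
    then have r: "norm (perpetuity_sum s \<omega>) \<le> real r + real L * R" for s
      using L unfolding F_def by (auto simp: not_less)
    have "norm (left_product n \<omega> *v snd (\<omega> n)) \<le> 2 * (real r + real L * R)" for n
    proof -
      have "left_product n \<omega> *v snd (\<omega> n) = perpetuity_sum (Suc n) \<omega> - perpetuity_sum n \<omega>"
        by (simp add: perpetuity_sum_def)
      then show ?thesis
        using norm_triangle_ineq4[of "perpetuity_sum (Suc n) \<omega>" "perpetuity_sum n \<omega>"] r[of n] r[of "Suc n"]
        by simp
    qed
    then show ?case by (auto intro!: bdd_aboveI)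
  qed
qed

end

section \<open>Convergence in distribution\<close>

lemma distr_Pair_if_indep_rvs:
  assumes "prob_space P" and indep: "indep_rvs P S X T Y"
  shows "distr P (S \<Otimes>\<^sub>M T) (\<lambda>\<omega>. (X \<omega>, Y \<omega>)) = distr P S X \<Otimes>\<^sub>M distr P T Y"
proof -
  interpret prob_space P by fact
  have [measurable]: "X \<in> P \<rightarrow>\<^sub>M S" "Y \<in> P \<rightarrow>\<^sub>M T"
    and ind: "indep_set {X -` A \<inter> space P |A. A \<in> sets S} {Y -` B \<inter> space P |B. B \<in> sets T}"
    using indep by (auto simp: indep_rvs_def)
  interpret X: prob_space "distr P S X" by (rule prob_space_distr) simp
  interpret Y: prob_space "distr P T Y" by (rule prob_space_distr) simp
  show ?thesis
  proof (rule pair_measure_eqI[symmetric])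
    fix A B assume "A \<in> sets (distr P S X)" "B \<in> sets (distr P T Y)"
    then have [measurable]: "A \<in> sets S" "B \<in> sets T" by simp_all
    have "prob ((X -` A \<inter> space P) \<inter> (Y -` B \<inter> space P)) = prob (X -` A \<inter> space P) * prob (Y -` B \<inter> space P)"
      using ind by (rule indep_setD) auto
    moreover have "(\<lambda>\<omega>. (X \<omega>, Y \<omega>)) -` (A \<times> B) \<inter> space P = (X -` A \<inter> space P) \<inter> (Y -` B \<inter> space P)"
      by auto
    ultimately show "emeasure (distr P S X) A * emeasure (distr P T Y) B
        = emeasure (distr P (S \<Otimes>\<^sub>M T) (\<lambda>\<omega>. (X \<omega>, Y \<omega>))) (A \<times> B)"
      by (simp add: emeasure_distr emeasure_eq_measure ennreal_mult)
  qed (auto intro: X.sigma_finite_measure_axioms Y.sigma_finite_measure_axioms)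
qed

text \<open>Test functions that vanish on a ball and equal \<open>1\<close> outside a larger one carry the tail bound for the
  limit over to all late times; each of the finitely many early times has a bound of its own.\<close>

lemma tight_if_converges_in_distribution:
  fixes X :: "nat \<Rightarrow> 'w \<Rightarrow> 'a :: real_normed_vector"
  assumes "prob_space P" and X [measurable]: "\<And>n. X n \<in> borel_measurable P"
    and conv: "converges_in_distribution P X" and "0 < e"
  shows "\<exists>R. \<forall>n. measure P {\<omega> \<in> space P. R < norm (X n \<omega>)} \<le> e"
proof -
  interpret prob_space P by fact
  obtain \<mu> where \<mu>: "prob_space \<mu>" "sets \<mu> = sets borel"
    and lim: "\<And>f :: 'a \<Rightarrow> real. continuous_on UNIV f \<Longrightarrow> bounded (range f) \<Longrightarrow>
      (\<lambda>n. \<integral>x. f x \<partial>distr P borel (X n)) \<longlonglongrightarrow> (\<integral>x. f x \<partial>\<mu>)"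
    using conv unfolding converges_in_distribution_def by blast
  interpret \<mu>: prob_space \<mu> by fact
  note [measurable_cong] = \<mu>(2)
  define f where "f = (\<lambda>(k::nat) (x::'a). min 1 (max 0 (norm x - real k)))"
  have f_cont: "continuous_on UNIV (f k)" for k
    unfolding f_def by (intro continuous_intros)
  have f_bounded: "norm (f k x) \<le> 1" "0 \<le> f k x" for k x
    unfolding f_def by auto
  have [measurable]: "f k \<in> borel_measurable borel" for k
    by (rule borel_measurable_continuous_onI[OF f_cont])
  have "(\<lambda>k. \<integral>x. f k x \<partial>\<mu>) \<longlonglongrightarrow> (\<integral>x. 0 \<partial>\<mu>)"
  proof (rule integral_dominated_convergence[where w = "\<lambda>_. 1"])
    show "AE x in \<mu>. (\<lambda>k. f k x) \<longlonglongrightarrow> 0"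
    proof (rule AE_I2)
      fix x :: 'a
      obtain k0 where "norm x \<le> real k0"
        using real_arch_simple by blast
      then have "f k x = 0" if "k \<ge> k0" for k
        using that unfolding f_def by (simp add: max_def)
      then show "(\<lambda>k. f k x) \<longlonglongrightarrow> 0"
        by (intro tendsto_eventually) (auto simp: eventually_sequentially)
    qed
  qed (use f_bounded in auto)
  from order_tendstoD(2)[OF this, of e] \<open>0 < e\<close>
  obtain k where k: "(\<integral>x. f k x \<partial>\<mu>) < e"
    by (auto simp: eventually_sequentially)
  have "bounded (range (f k))"
    using f_bounded by (auto simp: bounded_iff)
  from order_tendstoD(2)[OF lim[OF f_cont this] k]
  obtain n0 where n0: "\<And>n. n \<ge> n0 \<Longrightarrow> (\<integral>x. f k x \<partial>distr P borel (X n)) < e"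
    by (auto simp: eventually_sequentially)
  have late: "prob {\<omega> \<in> space P. real k + 1 < norm (X n \<omega>)} \<le> e" if "n \<ge> n0" for n
  proof -
    let ?A = "{\<omega> \<in> space P. real k + 1 < norm (X n \<omega>)}"
    have "prob ?A = (\<integral>\<omega>. indicator ?A \<omega> \<partial>P)"
      by (simp add: Int_absorb2)
    also have "\<dots> \<le> (\<integral>\<omega>. f k (X n \<omega>) \<partial>P)"
    proof (rule integral_mono)
      show "integrable P (indicator ?A :: _ \<Rightarrow> real)"
        by (rule integrable_real_indicator) (measurable, simp add: emeasure_eq_measure)
      show "integrable P (\<lambda>\<omega>. f k (X n \<omega>))"
        by (rule integrable_const_bound[where B = 1]) (use f_bounded in auto)
      show "indicator ?A \<omega> \<le> f k (X n \<omega>)" for \<omega>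
        unfolding f_def by (auto simp: indicator_def)
    qed
    also have "\<dots> = (\<integral>x. f k x \<partial>distr P borel (X n))"
      by (rule integral_distr[symmetric]) simp_all
    finally show ?thesis
      using n0[OF that] by simp
  qed
  have "\<exists>r::nat. prob {\<omega> \<in> space P. real r < norm (X n \<omega>)} \<le> e" for n
  proof -
    have "(\<lambda>r. prob {\<omega> \<in> space P. real r < norm (X n \<omega>)}) \<longlonglongrightarrow> 0"
    proof (rule prob_tendsto_0_if_AE_eventually_not)
      show "AE \<omega> in P. eventually (\<lambda>r. \<not> real r < norm (X n \<omega>)) sequentially"
      proof (rule AE_I2)
        fix \<omega>
        obtain r0 where "norm (X n \<omega>) \<le> real r0"
          using real_arch_simple by blast
        then show "eventually (\<lambda>r. \<not> real r < norm (X n \<omega>)) sequentially"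
          unfolding eventually_sequentially by (intro exI[of _ r0]) auto
      qed
    qed simp
    from order_tendstoD(2)[OF this \<open>0 < e\<close>] show ?thesis
      by (auto simp: eventually_sequentially intro: less_imp_le)
  qed
  then obtain r :: "nat \<Rightarrow> nat" where r: "\<And>n. prob {\<omega> \<in> space P. real (r n) < norm (X n \<omega>)} \<le> e"
    by metis
  define R where "R = real k + 1 + real (\<Sum>n<n0. r n)"
  have "prob {\<omega> \<in> space P. R < norm (X n \<omega>)} \<le> e" for n
  proof (cases "n \<ge> n0")
    case True
    have "prob {\<omega> \<in> space P. R < norm (X n \<omega>)} \<le> prob {\<omega> \<in> space P. real k + 1 < norm (X n \<omega>)}"
      using sum_nonneg[of "{..<n0}" "\<lambda>n. real (r n)"]
      by (intro finite_measure_mono) (auto simp: R_def)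
    with late[OF True] show ?thesis by simp
  next
    case False
    then have "r n \<le> (\<Sum>n<n0. r n)"
      by (intro member_le_sum) auto
    then have "real (r n) \<le> R"
      unfolding R_def by linarith
    then have "prob {\<omega> \<in> space P. R < norm (X n \<omega>)} \<le> prob {\<omega> \<in> space P. real (r n) < norm (X n \<omega>)}"
      by (intro finite_measure_mono) auto
    with r[of n] show ?thesis by simp
  qed
  then show ?thesis by blast
qed

text \<open>Convergence in distribution sees only the individual laws, so it may be checked on variables with
  the same laws that converge almost surely.\<close>

lemma converges_in_distribution_if_same_law:
  fixes X Y :: "nat \<Rightarrow> 'w \<Rightarrow> 'a :: {banach, second_countable_topology}"
  assumes "prob_space P" and Y [measurable]: "\<And>n. Y n \<in> borel_measurable P"
    and law: "\<And>n. distr P borel (X n) = distr P borel (Y n)"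
    and conv: "AE \<omega> in P. convergent (\<lambda>n. Y n \<omega>)"
  shows "converges_in_distribution P X"
  unfolding converges_in_distribution_def
proof (intro exI conjI allI impI)
  interpret prob_space P by fact
  define W where "W = (\<lambda>\<omega>. lim (\<lambda>n. Y n \<omega>))"
  have [measurable]: "W \<in> borel_measurable P"
    unfolding W_def by measurable
  show "prob_space (distr P borel W)"
    by (rule prob_space_distr) simp
  show "sets (distr P borel W) = sets borel" by simp
  fix f :: "'a \<Rightarrow> real"
  assume f: "continuous_on UNIV f \<and> bounded (range f)"
  then have [measurable]: "f \<in> borel_measurable borel"
    by (intro borel_measurable_continuous_onI) simp
  obtain B where B: "\<And>x. norm (f x) \<le> B"
    using f by (auto simp: bounded_iff)
  have "(\<lambda>n. \<integral>\<omega>. f (Y n \<omega>) \<partial>P) \<longlonglongrightarrow> (\<integral>\<omega>. f (W \<omega>) \<partial>P)"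
  proof (rule integral_dominated_convergence[where w = "\<lambda>_. B"])
    show "AE \<omega> in P. (\<lambda>n. f (Y n \<omega>)) \<longlonglongrightarrow> f (W \<omega>)"
      using conv
    proof eventually_elim
      case (elim \<omega>)
      then have "(\<lambda>n. Y n \<omega>) \<longlonglongrightarrow> W \<omega>"
        by (simp add: W_def convergent_LIMSEQ_iff)
      then show ?case
        using f by (auto intro: continuous_on_tendsto_compose)
    qed
  qed (use B in auto)
  moreover have "(\<integral>x. f x \<partial>distr P borel (X n)) = (\<integral>\<omega>. f (Y n \<omega>) \<partial>P)" for n
    by (simp add: law integral_distr)
  moreover have "(\<integral>x. f x \<partial>distr P borel W) = (\<integral>\<omega>. f (W \<omega>) \<partial>P)"
    by (simp add: integral_distr)
  ultimately show "(\<lambda>n. \<integral>x. f x \<partial>distr P borel (X n)) \<longlonglongrightarrow> (\<integral>x. f x \<partial>distr P borel W)"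
    by simp
qed

text \<open>For \<open>n = 0\<close> the infimum over the empty set is \<open>\<infinity>\<close>, which agrees with the empty condition on the
  right.\<close>

lemma less_INF_ereal_iff:
  fixes f :: "nat \<Rightarrow> real"
  shows "ereal x < (INF k\<in>{1..n}. ereal (f k)) \<longleftrightarrow> (\<forall>k<n. x < f (Suc k))"
proof (cases n)
  case (Suc m)
  have "(INF k\<in>{1..n}. ereal (f k)) = Min ((\<lambda>k. ereal (f k)) ` {1..n})"
    by (rule Min_Inf[symmetric]) (auto simp: Suc)
  also have "ereal x < \<dots> \<longleftrightarrow> (\<forall>k\<in>{1..n}. x < f k)"
    by (subst Min_gr_iff) (auto simp: Suc)
  also have "\<dots> \<longleftrightarrow> (\<forall>k<n. x < f (Suc k))"
    unfolding image_Suc_lessThan[symmetric] by blast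
  finally show ?thesis .
qed (simp add: top_ereal_def)

section \<open>Passage to the product space\<close>

lemma law_of_iid_sequence_with_start:
  fixes X :: "nat \<Rightarrow> 'w \<Rightarrow> 'b" and Y :: "'w \<Rightarrow> 'a"
  assumes "prob_space P" and indep: "prob_space.indep_vars P (\<lambda>_. B) X {1..}"
    and ident: "\<And>t. t \<ge> 1 \<Longrightarrow> distr P B (X t) = N"
    and start: "indep_rvs P A Y (Pi\<^sub>M {1..} (\<lambda>_. B)) (\<lambda>\<omega>. \<lambda>t\<in>{1..}. X t \<omega>)"
  defines "S \<equiv> Pi\<^sub>M UNIV (\<lambda>_ :: nat. N)" and "\<Phi> \<equiv> \<lambda>\<omega> i. X (Suc i) \<omega>"
  shows "\<Phi> \<in> P \<rightarrow>\<^sub>M S"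
    and "distr P S \<Phi> = S"
    and "distr P (distr P A Y \<Otimes>\<^sub>M S) (\<lambda>\<omega>. (Y \<omega>, \<Phi> \<omega>)) = distr P A Y \<Otimes>\<^sub>M S"
proof -
  interpret prob_space P by fact
  define seq where "seq = (\<lambda>\<omega>. \<lambda>t\<in>{1..}. X t \<omega>)"
  define \<zeta> where "\<zeta> = distr P A Y"
  have rv: "X t \<in> P \<rightarrow>\<^sub>M B" if "t \<ge> 1" for t
    using indep that by (auto simp: indep_vars_def)
  have Y [measurable]: "Y \<in> P \<rightarrow>\<^sub>M A"
    and seq [measurable]: "seq \<in> P \<rightarrow>\<^sub>M Pi\<^sub>M {1..} (\<lambda>_. B)"
    using start by (simp_all add: indep_rvs_def seq_def)
  have sets_zeta [measurable_cong]: "sets \<zeta> = sets A"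
    by (simp add: \<zeta>_def)
  have sets_N [measurable_cong]: "sets N = sets B"
    using ident[of 1] by (metis order_refl sets_distr)
  have prob_N: "prob_space N"
    using prob_space_distr[OF rv, of 1] ident[of 1] by simp
  interpret S: prob_space S
    unfolding S_def by (intro prob_space_PiM prob_N)
  have seq_law: "distr P (Pi\<^sub>M {1..} (\<lambda>_. B)) seq = Pi\<^sub>M {1..} (\<lambda>_. N)"
  proof -
    have "distr P (Pi\<^sub>M {1..} (\<lambda>_. B)) seq = Pi\<^sub>M {1..} (\<lambda>t. distr P B (X t))"
      unfolding seq_def by (rule indep_vars_iff_distr_eq_PiM'[THEN iffD1]) (use rv indep in auto)
    also have "\<dots> = Pi\<^sub>M {1..} (\<lambda>_. N)"
      using ident by (intro PiM_cong refl) auto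
    finally show ?thesis .
  qed
  define relabel where "relabel = (\<lambda>w :: nat \<Rightarrow> 'b. \<lambda>i. w (Suc i))"
  have relabel [measurable]: "relabel \<in> Pi\<^sub>M {1..} (\<lambda>_. B) \<rightarrow>\<^sub>M S"
    unfolding relabel_def S_def
    by (rule measurable_PiM_single') (auto simp: space_PiM PiE_iff sets_eq_imp_space_eq[OF sets_N])
  have relabel': "relabel \<in> Pi\<^sub>M {1..} (\<lambda>_. N) \<rightarrow>\<^sub>M S"
    by measurable
  have relabel_law: "distr (Pi\<^sub>M {1..} (\<lambda>_. N)) S relabel = S"
    using distr_PiM_reindex[of "{1..}" "\<lambda>_. N" Suc UNIV] prob_N
    by (auto simp: relabel_def[abs_def] restrict_UNIV S_def)
  have \<Phi>_eq: "\<Phi> = (\<lambda>\<omega>. relabel (seq \<omega>))"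
    by (auto simp: \<Phi>_def seq_def relabel_def)
  show "\<Phi> \<in> P \<rightarrow>\<^sub>M S"
    unfolding \<Phi>_eq by measurable
  have "distr P S \<Phi> = distr (distr P (Pi\<^sub>M {1..} (\<lambda>_. B)) seq) S relabel"
    unfolding \<Phi>_eq by (subst distr_distr[OF relabel seq]) (simp add: o_def)
  then show "distr P S \<Phi> = S"
    by (simp only: seq_law relabel_law)
  have "distr P (A \<Otimes>\<^sub>M Pi\<^sub>M {1..} (\<lambda>_. B)) (\<lambda>\<omega>. (Y \<omega>, seq \<omega>)) = \<zeta> \<Otimes>\<^sub>M Pi\<^sub>M {1..} (\<lambda>_. N)"
    using distr_Pair_if_indep_rvs[OF assms(1) start] unfolding seq_def \<zeta>_def seq_law[unfolded seq_def] .
  moreover have "\<zeta> \<Otimes>\<^sub>M S = distr \<zeta> \<zeta> (\<lambda>z. z) \<Otimes>\<^sub>M distr (Pi\<^sub>M {1..} (\<lambda>_. N)) S relabel"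
    unfolding relabel_law distr_id2[OF refl] ..
  moreover have "\<dots> = distr (\<zeta> \<Otimes>\<^sub>M Pi\<^sub>M {1..} (\<lambda>_. N)) (\<zeta> \<Otimes>\<^sub>M S) (\<lambda>(z, w). (z, relabel w))"
    by (rule pair_measure_distr[OF measurable_ident_sets[OF refl] relabel'])
      (simp only: relabel_law S.sigma_finite_measure_axioms)
  ultimately have "\<zeta> \<Otimes>\<^sub>M S = distr (distr P (A \<Otimes>\<^sub>M Pi\<^sub>M {1..} (\<lambda>_. B)) (\<lambda>\<omega>. (Y \<omega>, seq \<omega>)))
      (\<zeta> \<Otimes>\<^sub>M S) (\<lambda>(z, w). (z, relabel w))"
    by simp
  also have "\<dots> = distr P (\<zeta> \<Otimes>\<^sub>M S) (\<lambda>\<omega>. (Y \<omega>, \<Phi> \<omega>))"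
  proof -
    have "(\<lambda>(z, w). (z, relabel w)) \<in> A \<Otimes>\<^sub>M Pi\<^sub>M {1..} (\<lambda>_. B) \<rightarrow>\<^sub>M \<zeta> \<Otimes>\<^sub>M S"
      by measurable
    moreover have "(\<lambda>\<omega>. (Y \<omega>, seq \<omega>)) \<in> P \<rightarrow>\<^sub>M A \<Otimes>\<^sub>M Pi\<^sub>M {1..} (\<lambda>_. B)"
      by measurable
    ultimately show ?thesis
      by (subst distr_distr) (simp_all only: \<Phi>_eq o_def case_prod_conv)
  qed
  finally show "distr P (distr P A Y \<Otimes>\<^sub>M S) (\<lambda>\<omega>. (Y \<omega>, \<Phi> \<omega>)) = distr P A Y \<Otimes>\<^sub>M S"
    by (simp add: \<zeta>_def)
qed

lemma all_equivalent_if_iff: "list_all (\<lambda>p. p \<longleftrightarrow> q) ps \<Longrightarrow> all_equivalent ps"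
  unfolding all_equivalent_def list_all_iff by blast

theorem theorem2p1:
  fixes P :: "'w measure"
    and M :: "nat \<Rightarrow> 'w \<Rightarrow> real ^ 'd ^ 'd"
    and Z :: "nat \<Rightarrow> 'w \<Rightarrow> real ^ 'd"
  assumes "prob_space P"
    and "prob_space.indep_vars P (\<lambda>t. borel \<Otimes>\<^sub>M borel) (\<lambda>t \<omega>. (M t \<omega>, Z t \<omega>)) {1..}"
    and "\<And>t. t \<ge> 1 \<Longrightarrow>
      distr P (borel \<Otimes>\<^sub>M borel) (\<lambda>\<omega>. (M t \<omega>, Z t \<omega>)) =
      distr P (borel \<Otimes>\<^sub>M borel) (\<lambda>\<omega>. (M 1 \<omega>, Z 1 \<omega>))"
    and "indep_rvs P borel (Z 0)
      (Pi\<^sub>M {1..} (\<lambda>t. borel \<Otimes>\<^sub>M borel)) (\<lambda>\<omega>. \<lambda>t\<in>{1..}. (M t \<omega>, Z t \<omega>))"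
    and "AE \<omega> in P. (\<lambda>n. spectral_norm (mat_prod (\<lambda>t. M t \<omega>) 1 n)) \<longlonglongrightarrow> 0"
  shows "all_equivalent
    [converges_in_distribution P (affine_recursion M Z),
     AE \<omega> in P. summable (\<lambda>n. norm (mat_prod (\<lambda>j. M j \<omega>) 1 n *v Z (Suc n) \<omega>)),
     AE \<omega> in P. convergent (\<lambda>t. \<Sum>i=1..t. mat_prod (\<lambda>j. M j \<omega>) 1 (i - 1) *v Z i \<omega>),
     AE \<omega> in P. (\<lambda>t. mat_prod (\<lambda>j. M j \<omega>) 1 (t - 1) *v Z t \<omega>) \<longlonglongrightarrow> 0,
     AE \<omega> in P. bdd_above ((\<lambda>t. norm (mat_prod (\<lambda>j. M j \<omega>) 1 (t - 1) *v Z t \<omega>)) ` {1..}),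
     \<forall>x>0. summable (\<lambda>n. measure P {\<omega> \<in> space P.
       (INF k\<in>{1..n}. ereal (norm (mat_prod (\<lambda>j. M j \<omega>) k n *v Z (Suc n) \<omega>))) > ereal x})]"
proof -
  interpret P0: prob_space P by fact
  let ?B = "borel \<Otimes>\<^sub>M borel :: ((real ^ 'd ^ 'd) \<times> (real ^ 'd)) measure"
  define N where "N = distr P ?B (\<lambda>\<omega>. (M 1 \<omega>, Z 1 \<omega>))"
  define \<zeta> where "\<zeta> = distr P borel (Z 0)"
  define \<Phi> where "\<Phi> = (\<lambda>\<omega> i. (M (Suc i) \<omega>, Z (Suc i) \<omega>))"
  have ident: "distr P ?B (\<lambda>\<omega>. (M t \<omega>, Z t \<omega>)) = N" if "t \<ge> 1" for t
    unfolding N_def by (rule assms(3)[OF that])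
  have Z0 [measurable]: "Z 0 \<in> borel_measurable P"
    using assms(4) by (simp add: indep_rvs_def)
  have "(\<lambda>\<omega>. (M 1 \<omega>, Z 1 \<omega>)) \<in> P \<rightarrow>\<^sub>M ?B"
    using assms(2) by (auto simp: P0.indep_vars_def)
  then have prob_N: "prob_space N"
    unfolding N_def by (rule P0.prob_space_distr)
  have prob_zeta: "prob_space \<zeta>"
    unfolding \<zeta>_def by (rule P0.prob_space_distr) simp
  interpret N: prob_space N by fact
  interpret sequence_space N ..
  have \<Phi> [measurable]: "\<Phi> \<in> P \<rightarrow>\<^sub>M S"
    and \<Phi>_law: "distr P S \<Phi> = S"
    and joint_law: "distr P (\<zeta> \<Otimes>\<^sub>M S) (\<lambda>\<omega>. (Z 0 \<omega>, \<Phi> \<omega>)) = \<zeta> \<Otimes>\<^sub>M S"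
    using law_of_iid_sequence_with_start[OF assms(1,2) ident assms(4)]
    unfolding \<Phi>_def \<zeta>_def by simp_all
  have AE_iff: "(AE \<omega> in P. Q (\<Phi> \<omega>)) \<longleftrightarrow> (AE w in S. Q w)" if [measurable]: "Measurable.pred S Q" for Q
  proof -
    have "(AE w in distr P S \<Phi>. Q w) \<longleftrightarrow> (AE \<omega> in P. Q (\<Phi> \<omega>))"
      by (rule AE_distr_iff) simp_all
    then show ?thesis by (simp only: \<Phi>_law)
  qed

  \<comment> \<open>Every quantity in the statement is a function of the sequence \<open>\<Phi> \<omega>\<close>, apart from the initial
    value.\<close>
  have prod_\<Phi>: "mat_prod (\<lambda>j. M j \<omega>) (Suc k) n = left_product (n - k) (seq_shift k (\<Phi> \<omega>))" for k n \<omega>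
  proof -
    have "mat_prod (\<lambda>j. M j \<omega>) (Suc k) n = mat_prod (\<lambda>j. fst (\<Phi> \<omega> (j - 1))) (Suc k) n"
      by (rule mat_prod_cong) (auto simp: \<Phi>_def)
    then show ?thesis
      by (simp only: mat_prod_eq_left_product)
  qed
  have prod1_\<Phi>: "mat_prod (\<lambda>j. M j \<omega>) 1 n = left_product n (\<Phi> \<omega>)" for n \<omega>
    using prod_\<Phi>[of \<omega> 0 n] by simp
  have Z_\<Phi>: "Z (Suc n) \<omega> = snd (\<Phi> \<omega> n)" for n \<omega>
    by (simp add: \<Phi>_def)
  have recursion_\<Phi>: "affine_recursion M Z n \<omega> = forward n (Z 0 \<omega>) (\<Phi> \<omega>)" for n \<omega>
    by (induction n) (simp_all add: \<Phi>_def)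

  interpret started_affine_sequence N \<zeta>
    by (intro started_affine_sequence.intro affine_sequence.intro affine_sequence_axioms.intro
        started_affine_sequence_axioms.intro prob_zeta sequence_space_axioms)
      (simp_all add: \<zeta>_def N_def)
  interpret contracting_affine_sequence N
  proof
    show "AE \<omega> in S. (\<lambda>n. spectral_norm (left_product n \<omega>)) \<longlonglongrightarrow> 0"
      using assms(5) unfolding prod1_\<Phi> by (subst (asm) AE_iff) simp_all
  qed

  let ?a = "\<lambda>n w. left_product n w *v snd (w n) :: real ^ 'd"
  have eq2: "norm (mat_prod (\<lambda>j. M j \<omega>) 1 n *v Z (Suc n) \<omega>) = norm (?a n (\<Phi> \<omega>))" for n \<omega>
    by (simp only: prod1_\<Phi> Z_\<Phi>)
  have eq3: "(\<Sum>i=1..t. mat_prod (\<lambda>j. M j \<omega>) 1 (i - 1) *v Z i \<omega>) = perpetuity_sum t (\<Phi> \<omega>)" for t \<omega>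
    unfolding One_nat_def sum.atLeast1_atMost_eq by (simp add: perpetuity_sum_def prod1_\<Phi>[unfolded One_nat_def] Z_\<Phi>)
  have eq4: "(\<lambda>t. mat_prod (\<lambda>j. M j \<omega>) 1 (t - 1) *v Z t \<omega>) \<longlonglongrightarrow> 0 \<longleftrightarrow> (\<lambda>n. ?a n (\<Phi> \<omega>)) \<longlonglongrightarrow> 0" for \<omega>
    by (subst filterlim_sequentially_Suc[symmetric]) (simp add: prod1_\<Phi>[unfolded One_nat_def] Z_\<Phi>)
  have eq5: "(\<lambda>t. norm (mat_prod (\<lambda>j. M j \<omega>) 1 (t - 1) *v Z t \<omega>)) ` {1..} = range (\<lambda>n. norm (?a n (\<Phi> \<omega>)))" for \<omega>
  proof -
    have "{1..} = range Suc"
      by (auto simp: image_iff Suc_le_eq gr0_conv_Suc)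
    then show ?thesis
      by (simp add: image_image prod1_\<Phi>[unfolded One_nat_def] Z_\<Phi>)
  qed
  have eq6: "ereal x < (INF k\<in>{1..n}. ereal (norm (mat_prod (\<lambda>j. M j \<omega>) k n *v Z (Suc n) \<omega>)))
      \<longleftrightarrow> stays_above x n (\<Phi> \<omega>)" for x n \<omega>
    unfolding less_INF_ereal_iff stays_above_def prod_\<Phi> Z_\<Phi> by (auto simp: seq_shift_def)

  \<comment> \<open>The reversal of time: the recursion and the backward iteration have the same law at each time.\<close>
  have forward_law: "distr P borel (affine_recursion M Z n) = distr (\<zeta> \<Otimes>\<^sub>M S) borel (\<lambda>(z, w). backward n z w)" for n
  proof -
    have "distr P borel (affine_recursion M Z n)
        = distr (distr P (\<zeta> \<Otimes>\<^sub>M S) (\<lambda>\<omega>. (Z 0 \<omega>, \<Phi> \<omega>))) borel (\<lambda>(z, w). forward n z w)"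
      by (subst distr_distr) (simp_all add: o_def recursion_\<Phi>[abs_def])
    then show ?thesis
      by (simp only: joint_law distr_forward_eq_backward)
  qed
  have backward_law: "distr P borel (\<lambda>\<omega>. backward n (Z 0 \<omega>) (\<Phi> \<omega>)) = distr (\<zeta> \<Otimes>\<^sub>M S) borel (\<lambda>(z, w). backward n z w)" for n
  proof -
    have "distr P borel (\<lambda>\<omega>. backward n (Z 0 \<omega>) (\<Phi> \<omega>))
        = distr (distr P (\<zeta> \<Otimes>\<^sub>M S) (\<lambda>\<omega>. (Z 0 \<omega>, \<Phi> \<omega>))) borel (\<lambda>(z, w). backward n z w)"
      by (subst distr_distr) (simp_all add: o_def)
    then show ?thesis
      by (simp only: joint_law)
  qed
  have [measurable]: "affine_recursion M Z n \<in> borel_measurable P" for n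
    unfolding recursion_\<Phi>[abs_def] by measurable

  have i_v: "AE w in S. bdd_above (range (\<lambda>n. norm (?a n w)))"
    if "converges_in_distribution P (affine_recursion M Z)"
  proof (rule AE_bounded_if_tight[OF tendsto_0])
    fix e :: real assume "0 < e"
    from tight_if_converges_in_distribution[OF assms(1) _ that this]
    obtain R where R: "\<And>n. measure P {\<omega> \<in> space P. R < norm (affine_recursion M Z n \<omega>)} \<le> e"
      by auto
    have "measure (\<zeta> \<Otimes>\<^sub>M S) {p \<in> space (\<zeta> \<Otimes>\<^sub>M S). R < norm (backward n (fst p) (snd p))} \<le> e" for n
    proof -
      have "measure (\<zeta> \<Otimes>\<^sub>M S) {p \<in> space (\<zeta> \<Otimes>\<^sub>M S). R < norm (backward n (fst p) (snd p))}
          = measure (distr (\<zeta> \<Otimes>\<^sub>M S) borel (\<lambda>(z, w). backward n z w)) {x. R < norm x}"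
        by (subst measure_distr) (auto intro!: arg_cong[where f = "measure _"])
      also have "\<dots> = measure P {\<omega> \<in> space P. R < norm (affine_recursion M Z n \<omega>)}"
        unfolding forward_law[symmetric]
        by (subst measure_distr) (auto intro!: arg_cong[where f = "measure _"])
      finally show ?thesis using R[of n] by simp
    qed
    then show "\<exists>R. \<forall>n. measure (\<zeta> \<Otimes>\<^sub>M S) {p \<in> space (\<zeta> \<Otimes>\<^sub>M S). R < norm (backward n (fst p) (snd p))} \<le> e"
      by blast
  qed
  have iii_i: "converges_in_distribution P (affine_recursion M Z)"
    if "AE \<omega> in P. convergent (\<lambda>t. perpetuity_sum t (\<Phi> \<omega>))"
  proof (rule converges_in_distribution_if_same_law[OF assms(1)])
    show "distr P borel (affine_recursion M Z n) = distr P borel (\<lambda>\<omega>. backward n (Z 0 \<omega>) (\<Phi> \<omega>))" for n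
      by (simp only: forward_law backward_law)
    show "AE \<omega> in P. convergent (\<lambda>n. backward n (Z 0 \<omega>) (\<Phi> \<omega>))"
      using that assms(5)
    proof eventually_elim
      case (elim \<omega>)
      have "(\<lambda>n. spectral_norm (left_product n (\<Phi> \<omega>)) * norm (Z 0 \<omega>)) \<longlonglongrightarrow> 0"
        using elim(2) unfolding prod1_\<Phi> by (rule tendsto_mult_left_zero)
      then have "(\<lambda>n. left_product n (\<Phi> \<omega>) *v Z 0 \<omega>) \<longlonglongrightarrow> 0"
        by (rule Lim_null_comparison[rotated]) (simp add: norm_matrix_vector_mult_le)
      then show ?case
        unfolding backward_def using elim(1) by (intro convergent_add) (auto intro: convergentI)
    qed
  qed simp
  have v: "(AE \<omega> in P. bdd_above (range (\<lambda>n. norm (?a n (\<Phi> \<omega>)))))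
      \<longleftrightarrow> (AE w in S. bdd_above (range (\<lambda>n. norm (?a n w))))"
  proof (rule AE_iff)
    \<comment> \<open>Bounds in \<open>\<nat>\<close> suffice, which makes the event a countable union.\<close>
    have "bdd_above (range (\<lambda>n. norm (?a n w))) \<longleftrightarrow> (\<exists>m :: nat. \<forall>n. norm (?a n w) \<le> real m)" for w
      by (auto simp: bdd_above_def intro: order_trans) (meson order_trans real_arch_simple)
    then show "Measurable.pred S (\<lambda>w. bdd_above (range (\<lambda>n. norm (?a n w))))"
      by simp
  qed
  have vi: "measure P {\<omega> \<in> space P. stays_above x n (\<Phi> \<omega>)} = measure S {w \<in> space S. stays_above x n w}" for x n
  proof -
    have "measure S {w \<in> space S. stays_above x n w} = measure (distr P S \<Phi>) {w \<in> space S. stays_above x n w}"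
      by (simp only: \<Phi>_law)
    also have "\<dots> = measure P {\<omega> \<in> space P. stays_above x n (\<Phi> \<omega>)}"
      using measurable_space[OF \<Phi>]
      by (subst measure_distr) (auto intro!: arg_cong[where f = "measure _"])
    finally show ?thesis by simp
  qed
  have ii_iii: "AE \<omega> in P. convergent (\<lambda>t. perpetuity_sum t (\<Phi> \<omega>))"
    if "AE \<omega> in P. summable (\<lambda>n. norm (?a n (\<Phi> \<omega>)))"
    using that
    by eventually_elim (simp add: perpetuity_sum_def summable_norm_cancel summable_iff_convergent[symmetric])
  have iii_iv: "AE \<omega> in P. (\<lambda>n. ?a n (\<Phi> \<omega>)) \<longlonglongrightarrow> 0"
    if "AE \<omega> in P. convergent (\<lambda>t. perpetuity_sum t (\<Phi> \<omega>))"
    using that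
    by eventually_elim (simp add: perpetuity_sum_def summable_LIMSEQ_zero summable_iff_convergent[symmetric])
  have iv_v: "AE \<omega> in P. bdd_above (range (\<lambda>n. norm (?a n (\<Phi> \<omega>))))"
    if "AE \<omega> in P. (\<lambda>n. ?a n (\<Phi> \<omega>)) \<longlonglongrightarrow> 0"
    using that
  proof eventually_elim
    case (elim \<omega>)
    then have "Bseq (\<lambda>n. ?a n (\<Phi> \<omega>))"
      by (rule convergent_imp_Bseq[OF convergentI])
    then obtain K where "\<forall>n. norm (?a n (\<Phi> \<omega>)) \<le> K"
      by (rule BseqE)
    then show ?case
      by (intro bdd_aboveI2) (rule spec)
  qed
  have v_vi: "\<forall>x>0. summable (\<lambda>n. measure S {w \<in> space S. stays_above x n w})"
    if "AE w in S. bdd_above (range (\<lambda>n. norm (?a n w)))"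
    using summable_stays_above_if_AE_tendsto_0[OF AE_tendsto_0_if_AE_bounded[OF that]] by blast
  have vi_ii: "AE \<omega> in P. summable (\<lambda>n. norm (?a n (\<Phi> \<omega>)))"
    if "\<forall>x>0. summable (\<lambda>n. measure S {w \<in> space S. stays_above x n w})"
  proof -
    have "AE w in S. summable (\<lambda>n. norm (?a n w))"
      using that by (intro AE_summable_if_summable_stays_above[of 1]) simp_all
    then have "AE w in distr P S \<Phi>. summable (\<lambda>n. norm (?a n w))"
      by (simp only: \<Phi>_law)
    then show ?thesis
      by (rule AE_distrD[OF \<Phi>])
  qed

  let ?ii = "AE \<omega> in P. summable (\<lambda>n. norm (?a n (\<Phi> \<omega>)))"
  have "converges_in_distribution P (affine_recursion M Z) \<longleftrightarrow> ?ii"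
    using i_v v_vi vi_ii ii_iii iii_i by blast
  moreover have "(AE \<omega> in P. convergent (\<lambda>t. perpetuity_sum t (\<Phi> \<omega>))) \<longleftrightarrow> ?ii"
    using ii_iii iii_iv iv_v v v_vi vi_ii by blast
  moreover have "(AE \<omega> in P. (\<lambda>n. ?a n (\<Phi> \<omega>)) \<longlonglongrightarrow> 0) \<longleftrightarrow> ?ii"
    using ii_iii iii_iv iv_v v v_vi vi_ii by blast
  moreover have "(AE \<omega> in P. bdd_above (range (\<lambda>n. norm (?a n (\<Phi> \<omega>))))) \<longleftrightarrow> ?ii"
    using ii_iii iii_iv iv_v v v_vi vi_ii by blast
  moreover have "(\<forall>x>0. summable (\<lambda>n. measure S {w \<in> space S. stays_above x n w})) \<longleftrightarrow> ?ii"
    using ii_iii iii_iv iv_v v v_vi vi_ii by blast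
  ultimately show ?thesis
    unfolding eq2 eq3 eq4 eq5 eq6 vi
    by (intro all_equivalent_if_iff[where q = ?ii]) (simp only: list.pred_inject simp_thms)
qed

end
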